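(* Let $m\le n$, let $\mathcal{A}:\mathbb{R}^{m\times n}\to\mathbb{R}^p$ be linear, let $M\in\mathbb{R}^{m\times n}$ have rank $r\ge1$, let $f(X)=\frac12\|\mathcal{A}(X)-\mathcal{A}(M)\|^2$, let $\nu,\mu>0$, and let $\kappa\ge1$ be an integer. Put $F(U,V):=\nu f(UV^{\mathbb{T}})+\frac\mu4\|U^{\mathbb{T}}U-V^{\mathbb{T}}V\|_F^2$ for $(U,V)\in\mathbb{R}^{m\times\kappa}\times\mathbb{R}^{n\times\kappa}$. Suppose $\mathcal{X}^*\cap\Omega_\kappa\ne\emptyset$ and that the $2r$-restricted smallest eigenvalue $\alpha$ of $\mathcal{A}^*\mathcal{A}$ satisfies $\alpha>\frac{2}{\nu\sigma_r^2(M)}$. Let $\phi\in\mathscr{L}$ and $$\overline{\rho}:=\max\Big(1,\frac{\sqrt\nu\,\|\mathcal{A}\|\sqrt\kappa}{\sqrt{\nu\alpha}\,\sigma_r(M)-\sqrt2}\sqrt{1+\frac{2\sqrt r}{\sqrt\mu}}\Big)\phi_-'(1).$$ Then for every $\rho>\overline{\rho}$ the penalized problem $$\min_{(U,u)\in\mathbb{R}^{m\times\kappa}\times\mathbb{R}^\kappa,\ (V,v)\in\mathbb{R}^{n\times\kappa}\times\mathbb{R}^\kappa}\Big\{F(U,V)+\frac12\sum_{j=1}^\kappa\big[\phi(u_j)+\phi(v_j)+\rho(1-u_j)\|U_j\|+\rho(1-v_j)\|V_j\|\big]\Big\}\ \ {\rm s.t.}\ \ 0\le u\le e,\ 0\le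 v\le e$$ is a global exact penalty of the problem $$\min_{(U,u)\in\mathbb{R}^{m\times\kappa}\times\mathbb{R}^\kappa,\ (V,v)\in\mathbb{R}^{n\times\kappa}\times\mathbb{R}^\kappa}F(U,V)+\frac12\sum_{i=1}^\kappa\big(\phi(u_i)+\phi(v_i)\big)$$ $${\rm s.t.}\ \ 0\le u\le e,\ \langle e-u,\mathcal{G}(U)\rangle=0,\ 0\le v\le e,\ \langle e-v,\mathcal{G}(V)\rangle=0,$$ i.e. the two problems have the same set of global optimal solutions. Consequently, for every $\rho>\overline{\rho}$, the problem $$\min_{U\in\mathbb{R}^{m\times\kappa},V\in\mathbb{R}^{n\times\kappa}}\Big\{F(U,V)+\frac12\sum_{j=1}^\kappa\big[\theta(\rho\|U_j\|)+\theta(\rho\|V_j\|)\big]\Big\}$$ has the same global optimal solution set as $$\min_{U\in\mathbb{R}^{m\times\kappa},V\in\mathbb{R}^{n\times\kappa}}\Big\{F(U,V)+\frac12\big(\|U\|_{2,0}+\|V\|_{2,0}\big)\Big\}.$$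
   Context: $\|\cdot\|_F$ is the Frobenius norm; $U_j$ is the $j$-th column of $U$; $\|U\|_{2,0}$ is the number of nonzero columns of $U$; $\mathcal{G}(U):=(\|U_1\|,\ldots,\|U_\kappa\|)^{\mathbb{T}}$; $e$ is the all-ones vector, and vector inequalities are componentwise; $\|\mathcal{A}\|$ is the spectral (operator) norm of $\mathcal{A}$; $\sigma_i(M)$ is the $i$-th largest singular value; $\Omega_k:=\{X\in\mathbb{R}^{m\times n}:{\rm rank}(X)\le k\}$. The $k$-restricted smallest eigenvalue of $\mathcal{A}^*\mathcal{A}$ is $\min_{X\in\Omega_k,\|X\|_F=1}\|\mathcal{A}(X)\|^2$. $\mathcal{X}^*$ is the (assumed nonempty) set of global optimal solutions of $\min_{X\in\mathbb{R}^{m\times n}}\{\nu f(X)+{\rm rank}(X)\}$. $\mathscr{L}$ is the family of proper lower semicontinuous convex functions $\phi:\mathbb{R}\to(-\infty,+\infty]$ with $[0,1]\subseteq{\rm int}({\rm dom}\,\phi)$, $\phi(1)=1$, and $\phi(t_\phi^* )=0$ where $t_\phi^*=\arg\min_{t\in[0,1]}\phi(t)$. For $\phi\in\mathscr{L}$, $\psi(t)=\phi(t)$ if $t\in[0,1]$ and $+\infty$ otherwise, $\psi^*(s)=\sup_{t\in\mathbb{R}}\{st-\psi(t)\}$, $\theta(t):=|t|-\psi^*(|t|)$, and $\phi_-'(1)$ is the left derivative of $\phi$ at $1$. *)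

theory Defs
  imports "HOL-Analysis.Analysis" "HOL-Library.Multiset"
begin

text \<open>
  An \<open>m \<times> n\<close> matrix has type \<open>real^'n^'m\<close>. The instance \<open>norm\<close> on this type is the
  square root of the sum of the squared entries, that is, the Frobenius norm, and on
  \<open>real^'p\<close> it is the Euclidean norm. Hence \<open>onorm A\<close>, for linear
  \<open>A :: real^'n^'m \<Rightarrow> real^'p\<close>, is the spectral norm of \<open>A\<close>.
\<close>

definition global_solutions :: "('a \<Rightarrow> 'b::ord) \<Rightarrow> 'a set \<Rightarrow> 'a set" where
  "global_solutions g S = {x. is_arg_min g (\<lambda>y. y \<in> S) x}"

text \<open>
  Eigenvalues are repeated according to their geometric multiplicity. The definition is used
  for symmetric matrices only, where this is also the algebraic multiplicity and all
  eigenvalues are real.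
\<close>
definition eigenvalue_mset :: "real^'n^'n \<Rightarrow> real multiset" where
  "eigenvalue_mset B =
     (\<Sum>c\<in>{c. \<exists>x. x \<noteq> 0 \<and> B *v x = c *s x}. replicate_mset (dim {x. B *v x = c *s x}) c)"

text \<open>
  The \<open>i\<close>-th largest singular value, with \<open>i\<close> counted from 1. For an \<open>m \<times> n\<close> matrix with
  \<open>m \<le> n\<close>, the list has \<open>n\<close> entries; the last \<open>n - m\<close> of them are zeros beyond the
  usual \<open>m\<close> singular values and do not affect the indices \<open>1 \<le> i \<le> m\<close>.
\<close>
definition singular_value :: "nat \<Rightarrow> real^'n^'m \<Rightarrow> real" where
  "singular_value i M =
     rev (sorted_list_of_multiset (image_mset sqrt (eigenvalue_mset (transpose M ** M)))) ! (i - 1)"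

definition low_rank :: "nat \<Rightarrow> (real^'n^'m) set" where
  "low_rank k = {X. rank X \<le> k}"

text \<open>
  The infimum is a minimum for \<open>k \<ge> 1\<close>, because the set of matrices of rank at most \<open>k\<close>
  and of norm 1 is compact and nonempty.
\<close>
definition restricted_smallest_eigenvalue :: "nat \<Rightarrow> (real^'n^'m \<Rightarrow> real^'p) \<Rightarrow> real" where
  "restricted_smallest_eigenvalue k A = (INF X\<in>{X \<in> low_rank k. norm X = 1}. (norm (A X))\<^sup>2)"

definition sq_loss :: "(real^'n^'m \<Rightarrow> real^'p) \<Rightarrow> real^'n^'m \<Rightarrow> real^'n^'m \<Rightarrow> real" where
  "sq_loss A M X = 1/2 * (norm (A X - A M))\<^sup>2"

definition rank_min_solutions ::
  "(real^'n^'m \<Rightarrow> real^'p) \<Rightarrow> real^'n^'m \<Rightarrow> real \<Rightarrow> (real^'n^'m) set" where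
  "rank_min_solutions A M \<nu> = global_solutions (\<lambda>X. \<nu> * sq_loss A M X + real (rank X)) UNIV"

definition balanced_loss ::
  "(real^'n^'m \<Rightarrow> real^'p) \<Rightarrow> real^'n^'m \<Rightarrow> real \<Rightarrow> real \<Rightarrow> real^'k^'m \<Rightarrow> real^'k^'n \<Rightarrow> real" where
  "balanced_loss A M \<nu> \<mu> U V =
     \<nu> * sq_loss A M (U ** transpose V)
     + \<mu>/4 * (norm (transpose U ** U - transpose V ** V))\<^sup>2"

definition column_norms :: "real^'k^'m \<Rightarrow> real^'k" where
  "column_norms U = (\<chi> j. norm (column j U))"

definition norm20 :: "real^'k^'m \<Rightarrow> nat" where
  "norm20 U = card {j. column j U \<noteq> 0}"

definition edom :: "(real \<Rightarrow> ereal) \<Rightarrow> real set" where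
  "edom \<phi> = {t. \<phi> t < \<infinity>}"

definition proper_fun :: "(real \<Rightarrow> ereal) \<Rightarrow> bool" where
  "proper_fun \<phi> \<longleftrightarrow> (\<forall>t. \<phi> t \<noteq> -\<infinity>) \<and> edom \<phi> \<noteq> {}"

definition lsc_fun :: "(real \<Rightarrow> ereal) \<Rightarrow> bool" where
  "lsc_fun \<phi> \<longleftrightarrow> (\<forall>t. \<phi> t \<le> Liminf (at t) \<phi>)"

text \<open>In \<open>ereal\<close>, \<open>0 * \<infinity> = 0\<close>, so the cases \<open>c = 0\<close> and \<open>c = 1\<close> are trivial, as intended.\<close>
definition convex_fun :: "(real \<Rightarrow> ereal) \<Rightarrow> bool" where
  "convex_fun \<phi> \<longleftrightarrow>
     (\<forall>s t. \<forall>c\<in>{0..1}. \<phi> ((1 - c) * s + c * t) \<le> ereal (1 - c) * \<phi> s + ereal c * \<phi> t)"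

text \<open>
  The last condition says that \<open>\<phi>\<close> vanishes at a minimizer \<open>t\<close> of \<open>\<phi>\<close> over \<open>[0,1]\<close>;
  the minimizer is not required to be unique.
\<close>
definition surrogate_family :: "(real \<Rightarrow> ereal) set" where
  "surrogate_family =
     {\<phi>. proper_fun \<phi> \<and> lsc_fun \<phi> \<and> convex_fun \<phi> \<and> {0..1} \<subseteq> interior (edom \<phi>) \<and>
         \<phi> 1 = 1 \<and> (\<exists>t. is_arg_min \<phi> (\<lambda>s. s \<in> {0..1}) t \<and> \<phi> t = 0)}"

text \<open>Used at interior points of the domain of a convex function, where the derivative exists.\<close>
definition left_deriv :: "(real \<Rightarrow> ereal) \<Rightarrow> real \<Rightarrow> real" where
  "left_deriv \<phi> t = (THE D. ((\<lambda>s. real_of_ereal (\<phi> s)) has_real_derivative D) (at_left t))"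

definition restrict01 :: "(real \<Rightarrow> ereal) \<Rightarrow> real \<Rightarrow> ereal" where
  "restrict01 \<phi> t = (if t \<in> {0..1} then \<phi> t else \<infinity>)"

definition fenchel_conjugate :: "(real \<Rightarrow> ereal) \<Rightarrow> real \<Rightarrow> ereal" where
  "fenchel_conjugate \<psi> s = (SUP t. ereal (s * t) - \<psi> t)"

definition theta :: "(real \<Rightarrow> ereal) \<Rightarrow> real \<Rightarrow> ereal" where
  "theta \<phi> t = ereal \<bar>t\<bar> - fenchel_conjugate (restrict01 \<phi>) \<bar>t\<bar>"

text \<open>Points of the lifted problems are the tuples \<open>(U, u, V, v)\<close>.\<close>

definition box_set :: "((real^'k^'m) \<times> (real^'k) \<times> (real^'k^'n) \<times> (real^'k)) set" where
  "box_set = {(U, u, V, v). 0 \<le> u \<and> u \<le> 1 \<and> 0 \<le> v \<and> v \<le> 1}"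

definition complementarity_set :: "((real^'k^'m) \<times> (real^'k) \<times> (real^'k^'n) \<times> (real^'k)) set" where
  "complementarity_set =
     {(U, u, V, v). 0 \<le> u \<and> u \<le> 1 \<and> (1 - u) \<bullet> column_norms U = 0 \<and>
                    0 \<le> v \<and> v \<le> 1 \<and> (1 - v) \<bullet> column_norms V = 0}"

definition mpec_objective ::
  "(real^'n^'m \<Rightarrow> real^'p) \<Rightarrow> real^'n^'m \<Rightarrow> real \<Rightarrow> real \<Rightarrow> (real \<Rightarrow> ereal)
   \<Rightarrow> (real^'k^'m) \<times> (real^'k) \<times> (real^'k^'n) \<times> (real^'k) \<Rightarrow> ereal" where
  "mpec_objective A M \<nu> \<mu> \<phi> = (\<lambda>(U, u, V, v).
     ereal (balanced_loss A M \<nu> \<mu> U V) + ereal (1/2) * (\<Sum>j\<in>UNIV. \<phi> (u $ j) + \<phi> (v $ j)))"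

definition penalty_objective ::
  "(real^'n^'m \<Rightarrow> real^'p) \<Rightarrow> real^'n^'m \<Rightarrow> real \<Rightarrow> real \<Rightarrow> (real \<Rightarrow> ereal) \<Rightarrow> real
   \<Rightarrow> (real^'k^'m) \<times> (real^'k) \<times> (real^'k^'n) \<times> (real^'k) \<Rightarrow> ereal" where
  "penalty_objective A M \<nu> \<mu> \<phi> \<rho> = (\<lambda>(U, u, V, v).
     ereal (balanced_loss A M \<nu> \<mu> U V)
     + ereal (1/2) * (\<Sum>j\<in>UNIV. \<phi> (u $ j) + \<phi> (v $ j)
         + ereal (\<rho> * (1 - u $ j) * norm (column j U))
         + ereal (\<rho> * (1 - v $ j) * norm (column j V))))"

definition surrogate_objective ::
  "(real^'n^'m \<Rightarrow> real^'p) \<Rightarrow> real^'n^'m \<Rightarrow> real \<Rightarrow> real \<Rightarrow> (real \<Rightarrow> ereal) \<Rightarrow> real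
   \<Rightarrow> (real^'k^'m) \<times> (real^'k^'n) \<Rightarrow> ereal" where
  "surrogate_objective A M \<nu> \<mu> \<phi> \<rho> = (\<lambda>(U, V).
     ereal (balanced_loss A M \<nu> \<mu> U V)
     + ereal (1/2) * (\<Sum>j\<in>UNIV. theta \<phi> (\<rho> * norm (column j U)) + theta \<phi> (\<rho> * norm (column j V))))"

definition column_sparse_objective ::
  "(real^'n^'m \<Rightarrow> real^'p) \<Rightarrow> real^'n^'m \<Rightarrow> real \<Rightarrow> real
   \<Rightarrow> (real^'k^'m) \<times> (real^'k^'n) \<Rightarrow> real" where
  "column_sparse_objective A M \<nu> \<mu> = (\<lambda>(U, V).
     balanced_loss A M \<nu> \<mu> U V + 1/2 * (real (norm20 U) + real (norm20 V)))"

end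

theory Submission
  imports Defs
begin

text \<open>
  All four problems have optimal value \<open>r\<close>. A factorization of \<open>M\<close> read off its singular value
  decomposition is balanced, has zero loss and \<open>r\<close> nonzero columns on each side, so \<open>r\<close> is
  attained. For the lower bound, \<open>\<phi>\<close> lies above its tangent at 1 and is nonnegative, hence each
  column penalty is at least \<open>min 1 (\<tau> \<parallel>U\<^sub>j\<parallel>)\<close> with \<open>\<tau> = \<rho> / \<phi>'\<^sub>-(1)\<close>. If the sum of these
  truncated penalties and \<open>F\<close> were below \<open>r\<close>, at most \<open>r - k\<close> column pairs, with \<open>k \<ge> 1\<close>, would
  be untruncated on both sides. By the Eckart--Young bound
  \<open>\<parallel>Y - M\<parallel>\<^sub>F\<^sup>2 \<ge> k \<sigma>\<^sub>r(M)\<^sup>2\<close> for \<open>rank Y \<le> r - k\<close> and the restricted eigenvalue condition, the loss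
  at the product of these pairs exceeds \<open>k\<close>; the balancing term bounds the remaining
  pairs, and for \<open>\<tau>\<close> above the threshold they are too small to repair this. Since the
  bound holds on an open range of parameters, it is attained only where the penalty is exact.
\<close>

subsection \<open>Eigenvalues of symmetric matrices\<close>

lemma ex_eigenvector_in_invariant_subspace:
  fixes f :: "'a::euclidean_space \<Rightarrow> 'a"
  assumes lin: "linear f" and adj: "\<And>x y. f x \<bullet> y = x \<bullet> f y"
    and S: "subspace S" "S \<noteq> {0}" "f ` S \<subseteq> S"
  obtains x c where "x \<in> S" "norm x = 1" "f x = c *\<^sub>R x"
proof -
  obtain z where z: "z \<in> S" "z \<noteq> 0" using S subspace_0 by blast
  have "compact (sphere 0 1 \<inter> S)"
    using S(1) closed_subspace by (blast intro: compact_Int_closed compact_sphere)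
  moreover have "(1 / norm z) *\<^sub>R z \<in> sphere 0 1 \<inter> S"
    using z S(1) by (simp add: subspace_scale)
  moreover have "continuous_on (sphere 0 1 \<inter> S) (\<lambda>x. x \<bullet> f x)"
    by (intro continuous_intros linear_continuous_on_compose[OF _ lin])
  ultimately obtain x where x: "x \<in> sphere 0 1 \<inter> S"
    and mn: "\<And>y. y \<in> sphere 0 1 \<inter> S \<Longrightarrow> x \<bullet> f x \<le> y \<bullet> f y"
    using continuous_attains_inf by (metis empty_iff)
  define c where "c = x \<bullet> f x"
  have n1: "norm x = 1" and xS: "x \<in> S" and xx: "x \<bullet> x = 1"
    using x by (auto simp: norm_eq_1)
  have psd: "c * (y \<bullet> y) \<le> y \<bullet> f y" if "y \<in> S" for y
  proof (cases "y = 0")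
    case True then show ?thesis by simp
  next
    case False
    have "(1 / norm y) *\<^sub>R y \<in> sphere 0 1 \<inter> S"
      using that S(1) False by (simp add: subspace_scale)
    from mn[OF this] have "c \<le> (y \<bullet> f y) / (norm y)\<^sup>2"
      by (simp add: c_def linear_scale[OF lin] power2_eq_square)
    then show ?thesis
      using False by (simp add: pos_le_divide_eq flip: power2_norm_eq_inner)
  qed
  \<comment> \<open>A minimizer \<open>x\<close> of the Rayleigh quotient is an eigenvector: otherwise moving from \<open>x\<close>
    along the negative residual \<open>w\<close> would decrease the quotient.\<close>
  define w where "w = f x - c *\<^sub>R x"
  have wS: "w \<in> S"
    using S xS unfolding w_def by (intro subspace_diff subspace_scale) auto
  define g where "g = w \<bullet> f w - c * (w \<bullet> w)"
  have g0: "0 \<le> g" using psd[OF wS] by (simp add: g_def)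
  \<comment> \<open>For positive \<open>g\<close> the quadratic in \<open>t\<close> below is least
    at the squared norm of \<open>w\<close> over \<open>g\<close>. The added 1 permits
    \<open>g = 0\<close> and keeps \<open>t * g\<close> at most
    \<open>w \<bullet> w\<close>.\<close>
  define t where "t = (w \<bullet> w) / (1 + g)"
  have "x - t *\<^sub>R w \<in> S"
    using S wS xS by (intro subspace_diff subspace_scale) auto
  from psd[OF this] have "0 \<le> (x - t *\<^sub>R w) \<bullet> f (x - t *\<^sub>R w) - c * ((x - t *\<^sub>R w) \<bullet> (x - t *\<^sub>R w))"
    by simp
  also have "\<dots> = (x \<bullet> f x - c * (x \<bullet> x)) - t * (w \<bullet> f x + x \<bullet> f w - 2 * c * (w \<bullet> x)) + t\<^sup>2 * g"
    by (simp add: linear_diff[OF lin] linear_scale[OF lin] inner_diff_left inner_diff_right g_def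
        inner_commute power2_eq_square algebra_simps)
  also have "x \<bullet> f w = w \<bullet> f x" by (metis adj inner_commute)
  also have "w \<bullet> f x + w \<bullet> f x - 2 * c * (w \<bullet> x) = 2 * (w \<bullet> w)"
    by (simp add: w_def inner_diff_left inner_diff_right inner_commute algebra_simps)
  also have "x \<bullet> f x - c * (x \<bullet> x) = 0" by (simp add: c_def xx)
  finally have "0 \<le> t * (t * g - 2 * (w \<bullet> w))" by (simp add: power2_eq_square algebra_simps)
  moreover have "t * g \<le> w \<bullet> w"
    using g0 by (simp add: t_def divide_le_eq mult_left_mono)
  ultimately have "0 \<le> t * - (w \<bullet> w)"
    using g0 by (smt (verit) divide_nonneg_nonneg inner_ge_zero mult_left_mono t_def)
  then have "(w \<bullet> w) * (w \<bullet> w) \<le> 0"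
    using g0 by (simp add: t_def field_simps mult_le_0_iff zero_le_mult_iff)
  then have "w = 0" by (metis inner_eq_zero_iff mult_eq_0_iff order_antisym zero_le_square)
  then show ?thesis using that xS n1 by (simp add: w_def)
qed

text \<open>Self-adjointness makes the orthogonal complement of an eigenvector inside
  \<open>S\<close> invariant again, so eigenvectors can be split off one at a time. Arbitrary
  invariant subspaces are treated so that the induction on \<open>dim S\<close> applies to that
  complement.\<close>

lemma orthonormal_eigenbasis_subspace:
  fixes f :: "'a::euclidean_space \<Rightarrow> 'a"
  assumes lin: "linear f" and adj: "\<And>x y. f x \<bullet> y = x \<bullet> f y"
    and "subspace S" "f ` S \<subseteq> S"
  shows "\<exists>Q. finite Q \<and> pairwise orthogonal Q \<and> (\<forall>q\<in>Q. norm q = 1) \<and> span Q = S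
           \<and> (\<forall>q\<in>Q. \<exists>c. f q = c *\<^sub>R q)"
  using assms(3,4)
proof (induction "dim S" arbitrary: S rule: less_induct)
  case less
  show ?case
  proof (cases "S = {0}")
    case True
    then show ?thesis by (intro exI[of _ "{}"]) auto
  next
    case False
    obtain x c where x: "x \<in> S" "norm x = 1" "f x = c *\<^sub>R x"
      using ex_eigenvector_in_invariant_subspace[OF lin adj less.prems(1) False less.prems(2)] .
    define T where "T = {y \<in> S. x \<bullet> y = 0}"
    have T: "subspace T"
      using less.prems(1) unfolding T_def subspace_def by (auto simp: inner_add_right)
    have "x \<notin> T" using x(2) by (auto simp: T_def)
    then have "T \<subset> S" using x(1) unfolding T_def by blast
    then have "dim T < dim S"
      using T less.prems(1) by (metis dim_psubset span_eq_iff)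
    moreover have "f ` T \<subseteq> T"
    proof clarify
      fix y assume y: "y \<in> T"
      have "x \<bullet> f y = f x \<bullet> y" by (simp add: adj)
      then show "f y \<in> T" using y less.prems(2) x(3) by (auto simp: T_def)
    qed
    ultimately obtain Q where Q: "finite Q" "pairwise orthogonal Q" "\<forall>q\<in>Q. norm q = 1"
      "span Q = T" "\<forall>q\<in>Q. \<exists>c. f q = c *\<^sub>R q"
      using less.hyps T by blast
    have orth: "x \<bullet> q = 0" if "q \<in> Q" for q
      using that Q(4) span_base by (fastforce simp: T_def)
    have "span (insert x Q) = S"
    proof
      show "span (insert x Q) \<subseteq> S"
        using x(1) Q(4) \<open>T \<subset> S\<close> less.prems(1)
        by (metis insert_subset order.trans psubset_imp_subset span_minimal span_superset)
      show "S \<subseteq> span (insert x Q)"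
      proof
        fix y assume y: "y \<in> S"
        have "x \<bullet> x = 1" using x(2) by (simp add: norm_eq_1)
        then have "y - (x \<bullet> y) *\<^sub>R x \<in> T"
          using y x(1) less.prems(1)
          by (auto simp: T_def inner_diff_right subspace_diff subspace_scale)
        then show "y \<in> span (insert x Q)" using Q(4) by (auto simp: span_insert)
      qed
    qed
    moreover have "pairwise orthogonal (insert x Q)"
      using Q(2) orth by (auto simp: pairwise_insert orthogonal_def inner_commute)
    ultimately show ?thesis
      using Q x by (intro exI[of _ "insert x Q"]) auto
  qed
qed

text \<open>Comparing coefficients in the basis \<open>Q\<close>, an eigenvector for
  \<open>c\<close> has no component along any \<open>q\<close> with \<open>l q \<noteq> c\<close>.
  So the other basis vectors, which are independent, span the eigenspace.\<close>

lemma dim_eigenspace_eq_card: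
  fixes f :: "'a::euclidean_space \<Rightarrow> 'a"
  assumes lin: "linear f"
    and Q: "finite Q" "pairwise orthogonal Q" "\<And>q. q \<in> Q \<Longrightarrow> norm q = 1" "span Q = UNIV"
    and ev: "\<And>q. q \<in> Q \<Longrightarrow> f q = l q *\<^sub>R q"
  shows "dim {x. f x = c *\<^sub>R x} = card {q \<in> Q. l q = c}"
proof -
  have "{x. f x = c *\<^sub>R x} = span {q \<in> Q. l q = c}"
  proof
    show "span {q \<in> Q. l q = c} \<subseteq> {x. f x = c *\<^sub>R x}"
    proof (rule span_minimal)
      show "subspace {x. f x = c *\<^sub>R x}"
        by (auto simp: subspace_def linear_0[OF lin] linear_add[OF lin] linear_scale[OF lin]
            scaleR_add_right)
    qed (use ev in auto)
    show "{x. f x = c *\<^sub>R x} \<subseteq> span {q \<in> Q. l q = c}"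
    proof
      fix x assume "x \<in> {x. f x = c *\<^sub>R x}"
      then have fx: "f x = c *\<^sub>R x" by simp
      have xe: "(\<Sum>q\<in>Q. (x \<bullet> q) *\<^sub>R q) = x"
        using Q by (intro orthonormal_basis_expand) auto
      have "f x = (\<Sum>q\<in>Q. (x \<bullet> q) *\<^sub>R f q)"
        by (subst xe[symmetric]) (simp add: linear_sum[OF lin] linear_scale[OF lin])
      also have "\<dots> = (\<Sum>q\<in>Q. (x \<bullet> q * l q) *\<^sub>R q)" using ev by simp
      finally have e: "(\<Sum>q\<in>Q. (x \<bullet> q * l q) *\<^sub>R q) = c *\<^sub>R x" using fx by simp
      have z: "x \<bullet> p = 0" if p: "p \<in> Q" "l p \<noteq> c" for p
      proof -
        have d: "q \<bullet> p = (if q = p then 1 else 0)" if "q \<in> Q" for q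
          using Q p that by (auto simp: pairwise_def orthogonal_def norm_eq_1)
        have "c * (x \<bullet> p) = (\<Sum>q\<in>Q. (x \<bullet> q * l q) *\<^sub>R q) \<bullet> p" unfolding e by simp
        also have "\<dots> = (\<Sum>q\<in>Q. if q = p then x \<bullet> p * l p else 0)"
          unfolding inner_sum_left by (rule sum.cong) (auto simp: d)
        also have "\<dots> = x \<bullet> p * l p" using Q(1) p by simp
        finally show ?thesis using p(2) by simp
      qed
      have "(\<Sum>q\<in>Q. (x \<bullet> q) *\<^sub>R q) \<in> span {q \<in> Q. l q = c}"
        by (rule span_sum) (use z in \<open>metis (mono_tags, lifting) mem_Collect_eq scale_eq_0_iff span_base span_scale span_zero\<close>)
      then show "x \<in> span {q \<in> Q. l q = c}" using xe by simp
    qed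
  qed
  moreover have "independent {q \<in> Q. l q = c}"
    using Q(2) Q(3)[of 0] by (intro pairwise_orthogonal_independent) (auto simp: pairwise_def)
  ultimately show ?thesis by (simp add: dim_eq_card_independent)
qed

text \<open>The definition counts eigenspace dimensions; this makes it computable from any
  orthonormal eigenbasis.\<close>

lemma eigenvalue_mset_eq_image_mset:
  fixes B :: "real^'n^'n"
  assumes Q: "finite Q" "pairwise orthogonal Q" "\<And>q. q \<in> Q \<Longrightarrow> norm q = 1" "span Q = UNIV"
    and ev: "\<And>q. q \<in> Q \<Longrightarrow> B *v q = l q *\<^sub>R q"
  shows "eigenvalue_mset B = image_mset l (mset_set Q)"
proof (rule multiset_eqI)
  fix c
  have dim: "dim {x. B *v x = c *s x} = card {q \<in> Q. l q = c}" for c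
    using dim_eigenspace_eq_card[of "(*v) B" Q l c] assms by (simp add: scalar_mult_eq_scaleR)
  have evs: "{c. \<exists>x. x \<noteq> 0 \<and> B *v x = c *s x} = l ` Q"
  proof
    show "l ` Q \<subseteq> {c. \<exists>x. x \<noteq> 0 \<and> B *v x = c *s x}"
    proof clarify
      fix q assume q: "q \<in> Q"
      then have "q \<noteq> 0" using Q(3) by fastforce
      then show "\<exists>x. x \<noteq> 0 \<and> B *v x = l q *s x"
        using ev[OF q] by (auto simp: scalar_mult_eq_scaleR)
    qed
    show "{c. \<exists>x. x \<noteq> 0 \<and> B *v x = c *s x} \<subseteq> l ` Q"
    proof clarify
      fix c x assume x: "x \<noteq> 0" "B *v x = c *s x"
      have "dim {x. B *v x = c *s x} \<noteq> 0" using x by (auto simp: dim_eq_0)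
      then have "{q \<in> Q. l q = c} \<noteq> {}" unfolding dim by (metis card.empty)
      then show "c \<in> l ` Q" by auto
    qed
  qed
  have "count (eigenvalue_mset B) c = (\<Sum>c'\<in>l ` Q. if c' = c then card {q \<in> Q. l q = c} else 0)"
    unfolding eigenvalue_mset_def evs count_sum by (rule sum.cong) (auto simp: dim)
  also have "\<dots> = card {q \<in> Q. l q = c}"
    using Q(1) by (auto simp: sum.delta intro!: sym[OF card_eq_0_iff[THEN iffD2]])
  also have "\<dots> = count (image_mset l (mset_set Q)) c"
    using Q(1) by (simp add: count_image_mset_eq_card_vimage)
  finally show "count (eigenvalue_mset B) c = count (image_mset l (mset_set Q)) c" .
qed

subsection \<open>Singular values and low-rank approximation\<close>

lemma gram_inner:
  fixes M :: "real^'n^'m"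
  shows "((transpose M ** M) *v x) \<bullet> y = (M *v x) \<bullet> (M *v y)"
  by (metis dot_lmul_matrix matrix_vector_mul_assoc transpose_matrix_vector)

text \<open>The eigenvalue of \<open>transpose M ** M\<close> at a unit eigenvector \<open>q\<close>
  is forced to be the square of \<open>norm (M *v q)\<close>, so the singular values can be read off
  \<open>Q\<close> without being named separately.\<close>

definition right_singular_basis :: "real^'n^'m \<Rightarrow> (real^'n) set \<Rightarrow> bool" where
  "right_singular_basis M Q \<longleftrightarrow>
     finite Q \<and> pairwise orthogonal Q \<and> (\<forall>q\<in>Q. norm q = 1) \<and> span Q = UNIV \<and>
     (\<forall>q\<in>Q. (transpose M ** M) *v q = (norm (M *v q))\<^sup>2 *\<^sub>R q)"

lemma ex_right_singular_basis: "\<exists>Q. right_singular_basis M Q"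
proof -
  let ?B = "transpose M ** M"
  have adj: "(?B *v x) \<bullet> y = x \<bullet> (?B *v y)" for x y
    by (metis gram_inner inner_commute)
  obtain Q where Q: "finite Q" "pairwise orthogonal Q" "\<forall>q\<in>Q. norm q = 1" "span Q = UNIV"
      "\<forall>q\<in>Q. \<exists>c. ?B *v q = c *\<^sub>R q"
    using orthonormal_eigenbasis_subspace[of "(*v) ?B" UNIV] adj by auto
  have "?B *v q = (norm (M *v q))\<^sup>2 *\<^sub>R q" if q: "q \<in> Q" for q
  proof -
    obtain c where c: "?B *v q = c *\<^sub>R q" using Q q by blast
    have "c = (?B *v q) \<bullet> q" using q Q(3) by (simp add: c norm_eq_1)
    also have "\<dots> = (norm (M *v q))\<^sup>2" by (simp add: gram_inner power2_norm_eq_inner)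
    finally show ?thesis using c by simp
  qed
  then show ?thesis unfolding right_singular_basis_def using Q by blast
qed

lemma right_singular_basis_inner:
  assumes "right_singular_basis M Q" "p \<in> Q" "q \<in> Q"
  shows "p \<bullet> q = (if p = q then 1 else 0)"
    and "(M *v p) \<bullet> (M *v q) = (if p = q then (norm (M *v p))\<^sup>2 else 0)"
proof -
  show *: "p \<bullet> q = (if p = q then 1 else 0)"
    using assms by (auto simp: right_singular_basis_def pairwise_def orthogonal_def norm_eq_1)
  have "(M *v p) \<bullet> (M *v q) = (norm (M *v p))\<^sup>2 * (p \<bullet> q)"
    using assms by (simp add: right_singular_basis_def flip: gram_inner)
  then show "(M *v p) \<bullet> (M *v q) = (if p = q then (norm (M *v p))\<^sup>2 else 0)"
    using * by simp
qed

lemma right_singular_basis_expand: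
  assumes "right_singular_basis M Q"
  shows "(\<Sum>q\<in>Q. (x \<bullet> q) *\<^sub>R q) = x"
  using assms by (intro orthonormal_basis_expand) (auto simp: right_singular_basis_def)

text \<open>The vectors \<open>M *v q\<close> are pairwise orthogonal and span the range, so the
  nonzero ones form a basis of it.\<close>

lemma card_right_singular_basis_eq_rank:
  assumes Q: "right_singular_basis M Q"
  shows "card {q \<in> Q. M *v q \<noteq> 0} = rank M"
proof -
  define P where "P = {q \<in> Q. M *v q \<noteq> 0}"
  have inj: "inj_on ((*v) M) P"
  proof (rule inj_onI)
    fix p q assume pq: "p \<in> P" "q \<in> P" and e: "M *v p = M *v q"
    have "(M *v p) \<bullet> (M *v q) \<noteq> 0" using pq e by (simp add: P_def)
    then show "p = q" using right_singular_basis_inner(2)[OF Q, of p q] pq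
      by (auto simp: P_def split: if_splits)
  qed
  have "pairwise orthogonal ((*v) M ` P)"
    using right_singular_basis_inner(2)[OF Q]
    by (fastforce simp: pairwise_def orthogonal_def P_def)
  then have ind: "independent ((*v) M ` P)"
    by (intro pairwise_orthogonal_independent) (auto simp: P_def)
  have "range ((*v) M) \<subseteq> span ((*v) M ` P)"
  proof clarify
    fix x
    have "M *v x = (\<Sum>q\<in>Q. (x \<bullet> q) *\<^sub>R (M *v q))"
      by (subst right_singular_basis_expand[OF Q, of x, symmetric])
        (simp add: linear_sum[OF matrix_vector_mul_linear] matrix_vector_mult_scaleR)
    also have "\<dots> \<in> span ((*v) M ` P)"
    proof (rule span_sum)
      fix q assume "q \<in> Q"
      then show "(x \<bullet> q) *\<^sub>R (M *v q) \<in> span ((*v) M ` P)"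
        by (cases "M *v q = 0") (auto simp: P_def span_zero intro!: span_scale intro: span_base)
    qed
    finally show "M *v x \<in> span ((*v) M ` P)" .
  qed
  then have "dim (range ((*v) M)) = card ((*v) M ` P)"
    using ind by (intro dim_unique) auto
  then show ?thesis using inj by (simp add: rank_dim_range card_image P_def)
qed

text \<open>Sorting puts the \<open>r\<close> positive entries in the last \<open>r\<close> places,
  and the entry of \<open>rev L\<close> at \<open>r - 1\<close>, counted from 0, is the first of
  these in \<open>L\<close>.\<close>

lemma sorted_nth_least_positive:
  fixes L :: "real list"
  assumes "sorted L" "length (filter (\<lambda>x. x > 0) L) = r" "r \<ge> 1"
  shows "rev L ! (r - 1) > 0" "\<And>x. x \<in> set L \<Longrightarrow> x > 0 \<Longrightarrow> rev L ! (r - 1) \<le> x"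
proof -
  let ?n = "length L"
  have c: "card {i. i < ?n \<and> L ! i > 0} = r"
    using assms(2) by (simp add: length_filter_conv_card)
  have "r \<le> ?n" using assms(2) length_filter_le by metis
  then have nth: "rev L ! (r - 1) = L ! (?n - r)"
    using assms(3) by (simp add: rev_nth)
  show "rev L ! (r - 1) > 0"
  proof (rule ccontr)
    assume a: "\<not> rev L ! (r - 1) > 0"
    have "{i. i < ?n \<and> L ! i > 0} \<subseteq> {?n - r<..<?n}"
    proof clarsimp
      fix i assume i: "i < ?n" "L ! i > 0"
      show "?n - r < i"
      proof (rule ccontr)
        assume "\<not> ?n - r < i"
        then have "L ! i \<le> L ! (?n - r)"
          using assms(1,3) \<open>r \<le> ?n\<close> by (intro sorted_nth_mono) auto
        then show False using a i nth by simp
      qed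
    qed
    then have "r \<le> card {?n - r<..<?n}" using c card_mono[of "{?n - r<..<?n}" "{i. i < ?n \<and> L ! i > 0}"] by simp
    then show False using assms(3) \<open>r \<le> ?n\<close> by simp
  qed
  show "rev L ! (r - 1) \<le> x" if x: "x \<in> set L" "x > 0" for x
  proof (rule ccontr)
    assume a: "\<not> rev L ! (r - 1) \<le> x"
    obtain j where j: "j < ?n" "L ! j = x" using x by (auto simp: in_set_conv_nth)
    have "j < ?n - r"
    proof (rule ccontr)
      assume "\<not> j < ?n - r"
      then have "L ! (?n - r) \<le> L ! j" using assms(1) j by (intro sorted_nth_mono) auto
      then show False using a nth j by simp
    qed
    moreover have "{j..<?n} \<subseteq> {i. i < ?n \<and> L ! i > 0}"
      using sorted_nth_mono[OF assms(1)] j x(2) by fastforce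
    then have "card {j..<?n} \<le> r" using c card_mono[of "{i. i < ?n \<and> L ! i > 0}" "{j..<?n}"] by simp
    ultimately show False using \<open>r \<le> ?n\<close> by simp
  qed
qed

text \<open>Exactly \<open>rank M\<close> of the values \<open>norm (M *v q)\<close> are positive,
  so the list entry that \<open>singular_value\<close> selects is the least of them.\<close>

lemma singular_value_rank:
  assumes Q: "right_singular_basis M Q" and "rank M \<ge> 1"
  shows "singular_value (rank M) M > 0"
    and "\<And>q. q \<in> Q \<Longrightarrow> M *v q \<noteq> 0 \<Longrightarrow> singular_value (rank M) M \<le> norm (M *v q)"
proof -
  let ?X = "image_mset (\<lambda>q. norm (M *v q)) (mset_set Q)"
  let ?L = "sorted_list_of_multiset ?X"
  have fin: "finite Q" using Q by (simp add: right_singular_basis_def)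
  have "eigenvalue_mset (transpose M ** M) = image_mset (\<lambda>q. (norm (M *v q))\<^sup>2) (mset_set Q)"
    using Q by (intro eigenvalue_mset_eq_image_mset) (auto simp: right_singular_basis_def)
  then have sv: "singular_value (rank M) M = rev ?L ! (rank M - 1)"
    by (simp add: singular_value_def image_mset.compositionality comp_def)
  have "length (filter (\<lambda>x. x > 0) ?L) = size (filter_mset (\<lambda>x. x > 0) ?X)"
    by (metis mset_filter mset_sorted_list_of_multiset size_mset)
  also have "\<dots> = card {q \<in> Q. M *v q \<noteq> 0}"
    using fin by (simp add: filter_mset_image_mset)
  also have "\<dots> = rank M" by (rule card_right_singular_basis_eq_rank[OF Q])
  finally have len: "length (filter (\<lambda>x. x > 0) ?L) = rank M" .
  note * = sorted_nth_least_positive[OF sorted_sorted_list_of_multiset len assms(2)]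
  show "singular_value (rank M) M > 0" using *(1) sv by simp
  show "singular_value (rank M) M \<le> norm (M *v q)" if "q \<in> Q" "M *v q \<noteq> 0" for q
    using *(2)[of "norm (M *v q)"] sv that fin by simp
qed

text \<open>In the coordinates \<open>x \<bullet> q\<close> both squared norms are sums of squares,
  the one of \<open>M *v x\<close> with weights \<open>(norm (M *v q))\<^sup>2\<close>. The span is
  the orthogonal complement of the kernel of \<open>M\<close>, so no weight vanishes.\<close>

lemma norm_ge_singular_value:
  assumes Q: "right_singular_basis M Q" and "rank M \<ge> 1"
    and x: "x \<in> span {q \<in> Q. M *v q \<noteq> 0}"
  shows "(singular_value (rank M) M * norm x)\<^sup>2 \<le> (norm (M *v x))\<^sup>2"
proof -
  let ?s = "singular_value (rank M) M" and ?P = "{q \<in> Q. M *v q \<noteq> 0}"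
  have fin: "finite ?P" using Q by (simp add: right_singular_basis_def)
  have xe: "x = (\<Sum>q\<in>?P. (x \<bullet> q) *\<^sub>R q)"
    using Q fin x
    by (intro orthonormal_basis_expand[symmetric]) (auto simp: right_singular_basis_def pairwise_def)
  have "(norm x)\<^sup>2 = (\<Sum>q\<in>?P. (x \<bullet> q)\<^sup>2)"
    unfolding power2_norm_eq_inner
    by (subst (2) xe) (simp add: inner_sum_right power2_eq_square)
  moreover have "(norm (M *v x))\<^sup>2 = (\<Sum>q\<in>?P. (norm (M *v q))\<^sup>2 * (x \<bullet> q)\<^sup>2)"
  proof -
    have "(norm (M *v x))\<^sup>2 = ((transpose M ** M) *v x) \<bullet> x"
      by (simp add: gram_inner power2_norm_eq_inner)
    also have "(transpose M ** M) *v x = (\<Sum>q\<in>?P. ((x \<bullet> q) * (norm (M *v q))\<^sup>2) *\<^sub>R q)"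
      using Q by (subst xe)
        (simp add: linear_sum[OF matrix_vector_mul_linear] matrix_vector_mult_scaleR right_singular_basis_def)
    finally show ?thesis
      by (simp add: inner_sum_left inner_commute[of x] power2_eq_square mult_ac)
  qed
  moreover have "(\<Sum>q\<in>?P. ?s\<^sup>2 * (x \<bullet> q)\<^sup>2) \<le> (\<Sum>q\<in>?P. (norm (M *v q))\<^sup>2 * (x \<bullet> q)\<^sup>2)"
  proof (rule sum_mono)
    fix q assume "q \<in> ?P"
    then show "?s\<^sup>2 * (x \<bullet> q)\<^sup>2 \<le> (norm (M *v q))\<^sup>2 * (x \<bullet> q)\<^sup>2"
      using singular_value_rank[OF Q assms(2)]
      by (intro mult_right_mono power_mono) (auto intro: less_imp_le)
  qed
  ultimately show ?thesis
    by (simp add: power_mult_distrib sum_distrib_left)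
qed

section \<open>Bessel's inequality, rank-nullity and the Eckart-Young bound\<close>

lemma bessel_inequality:
  fixes x :: "'a::real_inner"
  assumes fin: "finite Q" and "pairwise orthogonal Q" and "\<And>q. q \<in> Q \<Longrightarrow> norm q = 1"
  shows "(\<Sum>q\<in>Q. (x \<bullet> q)\<^sup>2) \<le> (norm x)\<^sup>2"
proof -
  let ?y = "\<Sum>q\<in>Q. (x \<bullet> q) *\<^sub>R q"
  have pq: "p \<bullet> q = (if p = q then 1 else 0)" if "p \<in> Q" "q \<in> Q" for p q
    using assms that by (auto simp: pairwise_def orthogonal_def norm_eq_1)
  have "?y \<bullet> q = x \<bullet> q" if q: "q \<in> Q" for q
  proof -
    have "?y \<bullet> q = (\<Sum>p\<in>Q. if p = q then x \<bullet> q else 0)"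
      unfolding inner_sum_left by (rule sum.cong) (auto simp: pq q)
    then show ?thesis using fin q by simp
  qed
  then have yy: "?y \<bullet> ?y = (\<Sum>q\<in>Q. (x \<bullet> q)\<^sup>2)"
    by (simp only: inner_sum_right[of ?y]) (simp add: power2_eq_square)
  have xy: "x \<bullet> ?y = (\<Sum>q\<in>Q. (x \<bullet> q)\<^sup>2)"
    by (simp add: inner_sum_right power2_eq_square)
  have "0 \<le> (x - ?y) \<bullet> (x - ?y)" by simp
  also have "\<dots> = (norm x)\<^sup>2 - (\<Sum>q\<in>Q. (x \<bullet> q)\<^sup>2)"
    using yy xy by (simp add: inner_diff_left inner_diff_right inner_commute power2_norm_eq_inner)
  finally show ?thesis by simp
qed

text \<open>Bessel's inequality for each row of \<open>X\<close>, summed over the rows.\<close>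

lemma sum_norm_orthonormal_le:
  fixes X :: "real^'n^'m"
  assumes "finite Q" "pairwise orthogonal Q" "\<And>q. q \<in> Q \<Longrightarrow> norm q = 1"
  shows "(\<Sum>q\<in>Q. (norm (X *v q))\<^sup>2) \<le> (norm X)\<^sup>2"
proof -
  have "(\<Sum>q\<in>Q. (norm (X *v q))\<^sup>2) = (\<Sum>q\<in>Q. \<Sum>i\<in>UNIV. (X $ i \<bullet> q)\<^sup>2)"
    unfolding power2_norm_eq_inner inner_vec_def[of "X *v _"]
    by (simp add: matrix_vector_mul_component power2_eq_square)
  also have "\<dots> = (\<Sum>i\<in>UNIV. \<Sum>q\<in>Q. (X $ i \<bullet> q)\<^sup>2)" by (rule sum.swap)
  also have "\<dots> \<le> (\<Sum>i\<in>UNIV. (norm (X $ i))\<^sup>2)"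
    using assms by (intro sum_mono bessel_inequality) auto
  also have "\<dots> = (norm X)\<^sup>2"
    by (simp add: power2_norm_eq_inner inner_vec_def[of X])
  finally show ?thesis .
qed

text \<open>The kernel is the orthogonal complement of the row space, whose dimension is
  \<open>rank X\<close>.\<close>

lemma dim_kernel:
  fixes X :: "real^'n^'m"
  shows "dim {x. X *v x = 0} + rank X = CARD('n)"
proof -
  have "{x. X *v x = 0} = {y \<in> UNIV. \<forall>x\<in>rows X. orthogonal x y}"
    by (auto simp: rows_def row_def orthogonal_def vec_lambda_eta vec_eq_iff[of _ "0::real^'m"] matrix_vector_mul_component)
  also have "\<dots> = {y \<in> UNIV. \<forall>x\<in>span (rows X). orthogonal x y}"
  proof -
    have "(\<forall>x\<in>rows X. orthogonal x y) \<longleftrightarrow> (\<forall>x\<in>span (rows X). orthogonal x y)" for y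
      by (auto intro: span_base dest: orthogonal_to_span simp: orthogonal_commute[of _ y])
    then show ?thesis by simp
  qed
  finally have "dim {x. X *v x = 0} + dim (span (rows X)) = dim (UNIV :: (real^'n) set)"
    using dim_subspace_orthogonal_to_vectors[of "span (rows X)" UNIV] by simp
  then show ?thesis by (simp add: row_rank_def)
qed

lemma norm_diff_low_rank_ge:
  fixes M Y :: "real^'n^'m"
  assumes "rank M \<ge> 1" and rk: "rank Y + k \<le> rank M"
  shows "real k * (singular_value (rank M) M)\<^sup>2 \<le> (norm (Y - M))\<^sup>2"
proof -
  let ?s = "singular_value (rank M) M"
  obtain Q where Q: "right_singular_basis M Q" using ex_right_singular_basis by blast
  \<comment> \<open>On \<open>ker Y \<inter> (ker M)\<^sup>\<bottom>\<close>, which has dimension at least \<open>k\<close>, the map \<open>Y - M\<close> equals \<open>- M\<close>.\<close>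
  let ?P = "{q \<in> Q. M *v q \<noteq> 0}"
  let ?K = "{x. Y *v x = 0}"
  have "independent ?P"
    using Q by (intro pairwise_orthogonal_independent) (auto simp: right_singular_basis_def pairwise_def)
  then have dP: "dim (span ?P) = rank M"
    using card_right_singular_basis_eq_rank[OF Q] by (simp add: dim_eq_card_independent)
  have K: "subspace ?K"
    by (simp add: subspace_def matrix_vector_right_distrib matrix_vector_mult_scaleR)
  \<comment> \<open>With \<open>n = CARD('n)\<close>, the intersection has dimension at least
    \<open>(n - rank Y) + rank M - n\<close>, which is at least \<open>k\<close>.\<close>
  have "dim {x + y |x y. x \<in> ?K \<and> y \<in> span ?P} + dim (?K \<inter> span ?P) = dim ?K + dim (span ?P)"
    using K by (intro dim_sums_Int) auto
  moreover have "dim {x + y |x y. x \<in> ?K \<and> y \<in> span ?P} \<le> CARD('n)"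
    by (rule dim_subset_UNIV_cart)
  ultimately have d: "k \<le> dim (?K \<inter> span ?P)"
    using dim_kernel[of Y] dP rk by linarith
  obtain B where B: "B \<subseteq> ?K \<inter> span ?P" "pairwise orthogonal B" "\<And>x. x \<in> B \<Longrightarrow> norm x = 1"
      "independent B" "card B = dim (?K \<inter> span ?P)"
    by (rule orthonormal_basis_subspace[OF subspace_inter[OF K subspace_span[of ?P]]]) (rule that; assumption)
  have "real k * ?s\<^sup>2 \<le> real (card B) * ?s\<^sup>2" using d B(5) by (intro mult_right_mono) auto
  also have "\<dots> = (\<Sum>x\<in>B. (?s * norm x)\<^sup>2)" using B(3) by simp
  also have "\<dots> \<le> (\<Sum>x\<in>B. (norm ((Y - M) *v x))\<^sup>2)"
  proof (rule sum_mono)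
    fix x assume x: "x \<in> B"
    then have "(Y - M) *v x = - (M *v x)" using B(1) by (auto simp: matrix_vector_mult_diff_rdistrib)
    then show "(?s * norm x)\<^sup>2 \<le> (norm ((Y - M) *v x))\<^sup>2"
      using norm_ge_singular_value[OF Q assms(1), of x] x B(1) by auto
  qed
  also have "\<dots> \<le> (norm (Y - M))\<^sup>2"
    using B by (intro sum_norm_orthonormal_le) (auto intro: independent_imp_finite)
  finally show ?thesis .
qed

subsection \<open>The surrogate functions\<close>

text \<open>The slopes of chords ending at \<open>c\<close> increase as \<open>t\<close> approaches
  \<open>c\<close>, and the chord to \<open>b\<close> on the other side bounds them. Hence they
  converge to their supremum \<open>D\<close>, and being below \<open>D\<close> is the tangent
  inequality.\<close>

lemma convex_on_left_derivative:
  fixes f :: "real \<Rightarrow> real"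
  assumes f: "convex_on {a..b} f" and c: "a < c" "c < b"
  obtains D where "(f has_real_derivative D) (at_left c)"
    and "\<And>t. t \<in> {a..c} \<Longrightarrow> f c - D * (c - t) \<le> f t"
proof -
  define s where "s t = (f t - f c) / (t - c)" for t
  define D where "D = (SUP t\<in>{a..<c}. s t)"
  have mono: "s t \<le> s t'" if "a \<le> t" "t < t'" "t' < c" for t t'
    using convex_on_slope_le(2)[OF f, of t c t'] that c by (simp add: s_def)
  have bound: "s t \<le> (f c - f b) / (c - b)" if "a \<le> t" "t < c" for t
    using convex_on_slope_le[OF f, of t b c] that c by (auto simp: s_def)
  have bdd: "bdd_above (s ` {a..<c})" using bound by (auto intro!: bdd_aboveI2)
  have le: "s t \<le> D" if "a \<le> t" "t < c" for t
    unfolding D_def using that by (intro cSUP_upper bdd) auto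
  have ev: "\<forall>\<^sub>F t in at_left c. t \<in> {x<..<c}" if "x < c" for x
    using that by (rule eventually_at_left_real)
  have "(s \<longlongrightarrow> D) (at_left c)"
  proof (rule increasing_tendsto)
    show "\<forall>\<^sub>F t in at_left c. s t \<le> D"
      using ev[OF c(1)] by eventually_elim (auto intro: le)
    fix x assume "x < D"
    then obtain t where t: "t \<in> {a..<c}" "x < s t"
      unfolding D_def using c bdd by (subst (asm) less_cSUP_iff) auto
    then have "t < c" by simp
    from ev[OF this] show "\<forall>\<^sub>F t in at_left c. x < s t"
      by eventually_elim (use mono t in fastforce)
  qed
  then have "(f has_real_derivative D) (at_left c)"
    by (simp add: has_field_derivative_iff s_def[abs_def])
  moreover have "f c - D * (c - t) \<le> f t" if "t \<in> {a..c}" for t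
  proof (cases "t = c")
    case False
    then have "s t \<le> D" "t < c" using le that by auto
    then show ?thesis by (simp add: s_def neg_divide_le_eq algebra_simps)
  qed simp
  ultimately show ?thesis using that by blast
qed

text \<open>Collects all that is used of \<open>\<phi>\<close>: real values on the unit interval, a
  zero there, and a tangent at 1 with slope at least 1.\<close>

lemma surrogate_family_properties:
  assumes phi: "\<phi> \<in> surrogate_family"
  obtains g :: "real \<Rightarrow> real" and t0 :: real where
    "\<And>t. t \<in> {0..1} \<Longrightarrow> \<phi> t = ereal (g t)" "\<And>t. t \<in> {0..1} \<Longrightarrow> 0 \<le> g t"
    "g 1 = 1" "t0 \<in> {0..1}" "g t0 = 0" "left_deriv \<phi> 1 \<ge> 1"
    "\<And>t. t \<in> {0..1} \<Longrightarrow> 1 - left_deriv \<phi> 1 * (1 - t) \<le> g t"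
proof -
  define g where "g = (\<lambda>t. real_of_ereal (\<phi> t))"
  have conv: "convex_fun \<phi>" and int: "{0..1} \<subseteq> interior (edom \<phi>)" and one: "\<phi> 1 = 1"
    and prp: "proper_fun \<phi>"
    using phi by (auto simp: surrogate_family_def)
  obtain t0 where t0: "t0 \<in> {0..1}" "\<phi> t0 = 0" "\<And>t. t \<in> {0..1} \<Longrightarrow> \<not> \<phi> t < \<phi> t0"
    using phi by (auto simp: surrogate_family_def is_arg_min_def)
  have "1 \<in> interior (edom \<phi>)" using int by auto
  \<comment> \<open>The interior condition leaves room to the right of 1, so that 1 lies inside an
    interval on which \<open>\<phi>\<close> is finite, as the existence of the left derivative
    demands.\<close>
  then obtain e where e: "e > 0" "cball 1 e \<subseteq> edom \<phi>" by (auto simp: mem_interior_cball)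
  have "{0..1 + e} \<subseteq> edom \<phi>"
  proof
    fix t assume t: "t \<in> {0..1 + e}"
    show "t \<in> edom \<phi>"
    proof (cases "t \<le> 1")
      case True
      then show ?thesis using int interior_subset t by (meson atLeastAtMost_iff subsetD)
    next
      case False
      then have "t \<in> cball 1 e" using t by (simp add: dist_real_def)
      then show ?thesis using e by blast
    qed
  qed
  then have g: "\<phi> t = ereal (g t)" if "t \<in> {0..1 + e}" for t
  proof -
    have "\<bar>\<phi> t\<bar> \<noteq> \<infinity>" using prp that \<open>{0..1 + e} \<subseteq> edom \<phi>\<close>
      by (auto simp: proper_fun_def edom_def)
    then show ?thesis by (simp add: g_def ereal_real')
  qed
  have cg: "convex_on {0..1 + e} g"
  proof (rule convex_onI)
    fix c s t :: real assume *: "0 < c" "c < 1" "s \<in> {0..1 + e}" "t \<in> {0..1 + e}"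
    have "(1 - c) *\<^sub>R s + c *\<^sub>R t \<in> {0..1 + e}"
      using * by (intro convexD_alt) auto
    moreover have "\<phi> ((1 - c) * s + c * t) \<le> ereal (1 - c) * \<phi> s + ereal c * \<phi> t"
      using conv * unfolding convex_fun_def by (meson atLeastAtMost_iff less_imp_le)
    ultimately show "g ((1 - c) *\<^sub>R s + c *\<^sub>R t) \<le> (1 - c) * g s + c * g t"
      using g * by simp
  qed auto
  obtain D where D: "(g has_real_derivative D) (at_left 1)"
      "\<And>t. t \<in> {0..1} \<Longrightarrow> g 1 - D * (1 - t) \<le> g t"
    using convex_on_left_derivative[OF cg, of 1] e by auto
  have ld: "left_deriv \<phi> 1 = D"
    unfolding left_deriv_def
  proof (rule the_equality)
    show "((\<lambda>s. real_of_ereal (\<phi> s)) has_real_derivative D) (at_left 1)" using D(1) by (simp add: g_def)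
    fix D' assume "((\<lambda>s. real_of_ereal (\<phi> s)) has_real_derivative D') (at_left 1)"
    then show "D' = D" using D(1) unfolding g_def has_field_derivative_iff
      by (intro tendsto_unique[OF trivial_limit_at_left_real]) auto
  qed
  have g1: "g 1 = 1" by (simp add: g_def one)
  have gt0: "g t0 = 0" by (simp add: g_def t0)
  \<comment> \<open>The tangent at 1 lies below \<open>g\<close>, hence is at most 0 at the zero
    \<open>t0\<close>.\<close>
  have "1 \<le> D"
  proof -
    have "1 \<le> D * (1 - t0)" using D(2)[of t0] t0 g1 gt0 by simp
    moreover have "0 \<le> D"
      using \<open>1 \<le> D * (1 - t0)\<close> t0(1) mult_nonpos_nonneg[of D "1 - t0"] by force
    ultimately show ?thesis using t0(1) mult_left_le[of "1 - t0" D] by auto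
  qed
  moreover have "0 \<le> g t" if "t \<in> {0..1}" for t
    using t0(3)[OF that] t0(2) g[of t] that e by simp
  ultimately show ?thesis
    using that[of g t0] g D(2) ld g1 gt0 t0(1) e by auto
qed

text \<open>For \<open>s \<le> D\<close>, multiply \<open>1 \<le> y + D * (1 - t)\<close> by
  \<open>s / D\<close> and use \<open>0 \<le> y\<close>; for larger \<open>s\<close>, enlarge
  \<open>D\<close> to \<open>s\<close>. It is applied with \<open>y\<close> a value of the surrogate
  at \<open>t\<close> and \<open>s\<close> equal to \<open>\<rho>\<close> times a column
  norm.\<close>

lemma surrogate_lower_bound:
  fixes s D t y :: real
  assumes "D > 0" "0 \<le> s" "t \<le> 1" "0 \<le> y" "1 - D * (1 - t) \<le> y"
  shows "min 1 (s / D) \<le> y + s * (1 - t)"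
proof (cases "s \<le> D")
  case True
  have "s / D * 1 \<le> s / D * (y + D * (1 - t))"
    using assms by (intro mult_left_mono) auto
  also have "\<dots> = s / D * y + s * (1 - t)" using assms(1) by (simp add: field_simps)
  also have "s / D * y \<le> y" using assms True by (intro mult_left_le_one_le) auto
  finally show ?thesis by simp
next
  case False
  have "D * (1 - t) \<le> s * (1 - t)" using False assms by (intro mult_right_mono) auto
  then show ?thesis using assms(5) by (simp add: min_def)
qed

text \<open>For \<open>0 \<le> s\<close>, \<open>theta \<phi> s\<close> is the infimum of
  \<open>g t + s * (1 - t)\<close> over the unit interval. The lower bound holds for every
  \<open>t\<close>; the upper one comes from \<open>t = 1\<close>, with value 1, and from
  \<open>t0\<close>, with value 0 when \<open>s = 0\<close>.\<close>

lemma theta_bounds: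
  assumes phi: "\<phi> \<in> surrogate_family" and s: "0 \<le> s"
  shows "ereal (min 1 (s / left_deriv \<phi> 1)) \<le> theta \<phi> s"
    and "theta \<phi> s \<le> ereal (if s = 0 then 0 else 1)"
proof -
  obtain g t0 where g: "\<And>t. t \<in> {0..1} \<Longrightarrow> \<phi> t = ereal (g t)" "\<And>t. t \<in> {0..1} \<Longrightarrow> 0 \<le> g t"
    "g 1 = 1" "t0 \<in> {0..1}" "g t0 = 0" "left_deriv \<phi> 1 \<ge> 1"
    "\<And>t. t \<in> {0..1} \<Longrightarrow> 1 - left_deriv \<phi> 1 * (1 - t) \<le> g t"
    by (rule surrogate_family_properties[OF phi]) (rule that; assumption)
  let ?m = "min 1 (s / left_deriv \<phi> 1)"
  let ?F = "fenchel_conjugate (restrict01 \<phi>) s"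
  have "ereal (s * t) - restrict01 \<phi> t \<le> ereal (s - ?m)" for t
  proof (cases "t \<in> {0..1}")
    case True
    then have "?m \<le> g t + s * (1 - t)"
      using g(2)[of t] g(6) g(7)[of t] s by (intro surrogate_lower_bound) auto
    then show ?thesis using True g(1) by (simp add: restrict01_def algebra_simps)
  qed (auto simp: restrict01_def)
  then have up: "?F \<le> ereal (s - ?m)"
    unfolding fenchel_conjugate_def by (rule SUP_least)
  have lo: "ereal (s * t - g t) \<le> ?F" if "t \<in> {0..1}" for t
    unfolding fenchel_conjugate_def
    by (rule SUP_upper2[of t]) (use that g(1) in \<open>auto simp: restrict01_def\<close>)
  have "ereal ?m = ereal s - ereal (s - ?m)" by simp
  also have "\<dots> \<le> ereal s - ?F" by (intro ereal_minus_mono up order_refl)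
  finally show "ereal ?m \<le> theta \<phi> s" using s by (simp add: theta_def)
  have "theta \<phi> s \<le> ereal s - ereal (s * t - g t)" if "t \<in> {0..1}" for t
    using ereal_minus_mono[OF order_refl lo[OF that], of "ereal s"] s by (simp add: theta_def)
  from this[of 1] this[of t0] show "theta \<phi> s \<le> ereal (if s = 0 then 0 else 1)"
    using g(3,4,5) by auto
qed

subsection \<open>Column penalties and the rank\<close>

definition outer_prod :: "real^'m \<Rightarrow> real^'n \<Rightarrow> real^'n^'m" where
  "outer_prod u v = (\<chi> i j. u $ i * v $ j)"

lemma norm_outer_prod: "norm (outer_prod u v) = norm u * norm v"
proof (rule power2_eq_imp_eq)
  show "(norm (outer_prod u v))\<^sup>2 = (norm u * norm v)\<^sup>2"
    by (simp add: power_mult_distrib power2_norm_eq_inner outer_prod_def inner_vec_def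
        sum_product) (simp add: mult_ac)
qed auto

lemma outer_prod_mult_vec: "outer_prod u v *v x = (v \<bullet> x) *\<^sub>R u"
  by (simp add: vec_eq_iff outer_prod_def matrix_vector_mult_def inner_vec_def sum_distrib_left
      sum_distrib_right mult_ac)

lemma mult_transpose_eq_sum_outer_prod:
  "U ** transpose V = (\<Sum>j\<in>UNIV. outer_prod (column j U) (column j V))"
  by (simp add: vec_eq_iff matrix_matrix_mult_def transpose_def outer_prod_def column_def)

lemma matrix_vector_mult_sum_left:
  fixes X :: "'a \<Rightarrow> real^'n^'m"
  shows "sum X I *v x = (\<Sum>i\<in>I. X i *v x)"
  by (induction I rule: infinite_finite_induct) (auto simp: matrix_vector_mult_add_rdistrib)

lemma rank_sum_outer_prod_le:
  assumes "finite J"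
  shows "rank (\<Sum>j\<in>J. outer_prod (f j) (g j)) \<le> card J"
proof -
  have "range ((*v) (\<Sum>j\<in>J. outer_prod (f j) (g j))) \<subseteq> span (f ` J)"
    by (auto simp: matrix_vector_mult_sum_left outer_prod_mult_vec intro!: span_sum span_scale
        intro: span_base)
  then have "dim (range ((*v) (\<Sum>j\<in>J. outer_prod (f j) (g j)))) \<le> card (f ` J)"
    using assms by (intro dim_le_card) auto
  then show ?thesis using card_image_le[OF assms, of f] by (simp add: rank_dim_range)
qed

lemma rank_diff_le:
  fixes X Y :: "real^'n^'m"
  shows "rank (X - Y) \<le> rank X + rank Y"
proof -
  let ?S = "{x + y |x y. x \<in> range ((*v) X) \<and> y \<in> range ((*v) Y)}"
  have "range ((*v) (X - Y)) \<subseteq> ?S"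
  proof clarify
    fix x
    have "(X - Y) *v x = X *v x + Y *v (- x)"
      by (simp add: matrix_vector_mult_diff_rdistrib linear_neg[OF matrix_vector_mul_linear])
    then show "\<exists>a b. (X - Y) *v x = a + b \<and> a \<in> range ((*v) X) \<and> b \<in> range ((*v) Y)" by blast
  qed
  then have "rank (X - Y) \<le> dim ?S" by (simp add: rank_dim_range dim_subset)
  also have "\<dots> \<le> rank X + rank Y"
    using dim_sums_Int[of "range ((*v) X)" "range ((*v) Y)"]
    by (simp add: rank_dim_range linear_subspace_image[OF matrix_vector_mul_linear])
  finally show ?thesis .
qed

text \<open>The gap is a diagonal entry of the difference of the Gram matrices.\<close>

lemma column_norm_gap_le:
  fixes U :: "real^'k^'m" and V :: "real^'k^'n"
  shows "\<bar>(norm (column j U))\<^sup>2 - (norm (column j V))\<^sup>2\<bar> \<le> norm (transpose U ** U - transpose V ** V)"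
proof -
  let ?G = "transpose U ** U - transpose V ** V"
  have "?G $ j $ j = (norm (column j U))\<^sup>2 - (norm (column j V))\<^sup>2"
    by (simp add: matrix_mult_transpose_dot_column power2_norm_eq_inner)
  moreover have "norm (?G $ j $ j) \<le> norm ?G"
    by (rule order_trans[OF Finite_Cartesian_Product.norm_nth_le Finite_Cartesian_Product.norm_nth_le])
  ultimately show ?thesis unfolding real_norm_def by argo
qed

section \<open>Consequences of the restricted eigenvalue condition\<close>

lemma restricted_smallest_eigenvalue_le:
  fixes A :: "real^'n^'m \<Rightarrow> real^'p"
  assumes A: "linear A" and X: "rank X \<le> k"
  shows "restricted_smallest_eigenvalue k A * (norm X)\<^sup>2 \<le> (norm (A X))\<^sup>2"
proof (cases "X = 0")
  case True
  then show ?thesis by (simp add: linear_0[OF A])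
next
  case False
  let ?Y = "(1 / norm X) *\<^sub>R X"
  have "range ((*v) ?Y) \<subseteq> range ((*v) X)"
    by (auto simp: scaleR_matrix_vector_assoc[symmetric] matrix_vector_mult_scaleR[symmetric])
  then have "rank ?Y \<le> rank X" by (simp add: rank_dim_range dim_subset)
  then have "restricted_smallest_eigenvalue k A \<le> (norm (A ?Y))\<^sup>2"
    unfolding restricted_smallest_eigenvalue_def
    by (intro cINF_lower bdd_belowI2[of _ 0]) (use False X in \<open>auto simp: low_rank_def\<close>)
  also have "\<dots> = (norm (A X))\<^sup>2 / (norm X)\<^sup>2"
    by (simp add: linear_scale[OF A] power_divide)
  finally show ?thesis using False by (simp add: pos_le_divide_eq)
qed

text \<open>Since \<open>Y - M\<close> has rank at most \<open>2 * rank M\<close>, the restricted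
  eigenvalue carries the Eckart-Young bound through \<open>A\<close>.\<close>

lemma linear_image_diff_low_rank_ge:
  fixes A :: "real^'n^'m \<Rightarrow> real^'p"
  assumes A: "linear A" and "rank M \<ge> 1" and rk: "rank Y + k \<le> rank M"
    and \<alpha>: "\<alpha> = restricted_smallest_eigenvalue (2 * rank M) A" "\<alpha> \<ge> 0"
  shows "\<alpha> * (real k * (singular_value (rank M) M)\<^sup>2) \<le> (norm (A Y - A M))\<^sup>2"
proof -
  have "\<alpha> * (real k * (singular_value (rank M) M)\<^sup>2) \<le> \<alpha> * (norm (Y - M))\<^sup>2"
    using norm_diff_low_rank_ge[OF assms(2) rk] \<alpha>(2) by (rule mult_left_mono)
  also have "\<dots> \<le> (norm (A (Y - M)))\<^sup>2"
    unfolding \<alpha>(1) using rank_diff_le[of Y M] rk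
    by (intro restricted_smallest_eigenvalue_le A) auto
  finally show ?thesis by (simp add: linear_diff[OF A])
qed

text \<open>The last inequality makes the denominator
  \<open>sqrt (\<nu> * \<alpha>) * \<sigma> - sqrt 2\<close> of the penalty threshold positive,
  where \<open>\<sigma>\<close> is the least positive singular value.\<close>

lemma restricted_eigenvalue_threshold:
  fixes A :: "real^'n^'m \<Rightarrow> real^'p"
  assumes "rank M \<ge> 1" "\<nu> > 0" "\<alpha> > 2 / (\<nu> * (singular_value (rank M) M)\<^sup>2)"
  shows "singular_value (rank M) M > 0" "\<alpha> > 0" "2 < \<nu> * \<alpha> * (singular_value (rank M) M)\<^sup>2"
proof -
  obtain Q where "right_singular_basis M Q" using ex_right_singular_basis by blast
  from singular_value_rank(1)[OF this assms(1)] show s: "singular_value (rank M) M > 0" .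
  then show "2 < \<nu> * \<alpha> * (singular_value (rank M) M)\<^sup>2"
    using assms(2,3) by (simp add: pos_divide_less_eq mult_ac)
  have "0 < 2 / (\<nu> * (singular_value (rank M) M)\<^sup>2)" using s assms(2) by simp
  then show "\<alpha> > 0" using assms(3) by linarith
qed

text \<open>Compare \<open>X\<close> with \<open>M\<close>, which has zero loss: saving
  \<open>k\<close> in rank would cost more than \<open>k\<close> in loss. This is how a solution of
  rank at most \<kappa> forces \<open>rank M\<close> to be at most \<kappa>.\<close>

lemma rank_le_of_rank_min_solution:
  fixes A :: "real^'n^'m \<Rightarrow> real^'p"
  assumes A: "linear A" and rM: "rank M \<ge> 1" and \<nu>: "\<nu> > 0"
    and \<alpha>: "\<alpha> = restricted_smallest_eigenvalue (2 * rank M) A"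
      "\<alpha> > 2 / (\<nu> * (singular_value (rank M) M)\<^sup>2)"
    and X: "X \<in> rank_min_solutions A M \<nu>"
  shows "rank M \<le> rank X"
proof (rule ccontr)
  assume "\<not> rank M \<le> rank X"
  define k where "k = rank M - rank X"
  have k: "rank X + k \<le> rank M" "real k = real (rank M) - real (rank X)" "0 < real k"
    using \<open>\<not> rank M \<le> rank X\<close> by (auto simp: k_def)
  note th = restricted_eigenvalue_threshold[OF rM \<nu> \<alpha>(2)]
  have "\<not> \<nu> * sq_loss A M M + real (rank M) < \<nu> * sq_loss A M X + real (rank X)"
    using X by (auto simp: rank_min_solutions_def global_solutions_def is_arg_min_def)
  then have "\<nu> / 2 * (norm (A X - A M))\<^sup>2 \<le> real k"
    using k by (simp add: sq_loss_def)
  moreover have "\<nu> / 2 * (\<alpha> * (real k * (singular_value (rank M) M)\<^sup>2)) \<le> \<nu> / 2 * (norm (A X - A M))\<^sup>2"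
    using linear_image_diff_low_rank_ge[OF A rM k(1) \<alpha>(1)] th \<nu> by (intro mult_left_mono) auto
  ultimately have "real k * (\<nu> * \<alpha> * (singular_value (rank M) M)\<^sup>2) \<le> real k * 2"
    by (simp add: mult_ac)
  then show False using k(3) th(3) by simp
qed

section \<open>A balanced factorization attaining the optimal value\<close>

lemma ex_balanced_factorization:
  fixes M :: "real^'n^'m"
  assumes "rank M \<le> CARD('k::finite)"
  obtains U :: "real^'k^'m" and V :: "real^'k^'n"
  where "U ** transpose V = M" "transpose U ** U = transpose V ** V"
    "norm20 U = rank M" "norm20 V = rank M"
proof -
  obtain Q where Q: "right_singular_basis M Q" using ex_right_singular_basis by blast
  define P where "P = {q \<in> Q. M *v q \<noteq> 0}"
  have fin: "finite P" using Q by (simp add: right_singular_basis_def P_def)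
  have cP: "card P = rank M" unfolding P_def by (rule card_right_singular_basis_eq_rank[OF Q])
  obtain K :: "'k set" where K: "card K = card P"
    using assms cP by (metis obtain_subset_with_card_n)
  obtain h where h: "bij_betw h K P"
    using finite_same_card_bij[OF finite[of K] fin K] by blast
  \<comment> \<open>The factors of the singular value decomposition, with the square root of each singular
    value given to both sides and padded by zero columns.\<close>
  define s where "s j = norm (M *v h j)" for j
  have hP: "h j \<in> P" if "j \<in> K" for j using h that by (auto simp: bij_betw_def)
  then have s: "s j > 0" if "j \<in> K" for j using that by (auto simp: s_def P_def)
  define u where "u j = (if j \<in> K then (1 / sqrt (s j)) *\<^sub>R (M *v h j) else 0)" for j
  define v where "v j = (if j \<in> K then sqrt (s j) *\<^sub>R h j else 0)" for j
  define U :: "real^'k^'m" where "U = (\<chi> i j. u j $ i)"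
  define V :: "real^'k^'n" where "V = (\<chi> i j. v j $ i)"
  have colU: "column j U = u j" and colV: "column j V = v j" for j
    by (simp_all add: U_def V_def column_def vec_eq_iff)
  have "(U ** transpose V) *v x = M *v x" for x
  proof -
    have "(U ** transpose V) *v x = (\<Sum>j\<in>UNIV. (v j \<bullet> x) *\<^sub>R u j)"
      by (simp add: mult_transpose_eq_sum_outer_prod colU colV matrix_vector_mult_sum_left outer_prod_mult_vec)
    also have "\<dots> = (\<Sum>j\<in>K. (h j \<bullet> x) *\<^sub>R (M *v h j))"
      using s[THEN less_imp_neq] by (intro sum.mono_neutral_cong_right) (auto simp: u_def v_def)
    also have "\<dots> = (\<Sum>q\<in>P. (q \<bullet> x) *\<^sub>R (M *v q))"
      by (rule sum.reindex_bij_betw[OF h])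
    also have "\<dots> = (\<Sum>q\<in>Q. (q \<bullet> x) *\<^sub>R (M *v q))"
      using Q by (intro sum.mono_neutral_left) (auto simp: P_def right_singular_basis_def)
    also have "\<dots> = M *v (\<Sum>q\<in>Q. (x \<bullet> q) *\<^sub>R q)"
      by (simp add: linear_sum[OF matrix_vector_mul_linear] matrix_vector_mult_scaleR inner_commute)
    also have "\<dots> = M *v x" by (simp add: right_singular_basis_expand[OF Q])
    finally show ?thesis .
  qed
  then have "U ** transpose V = M" by (simp add: matrix_eq)
  \<comment> \<open>Both Gram matrices are diagonal, with entry \<open>s j\<close> for
    \<open>j \<in> K\<close> and 0 otherwise.\<close>
  moreover have "u i \<bullet> u j = v i \<bullet> v j" for i j
  proof (cases "i \<in> K \<and> j \<in> K")
    case True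
    then have ij: "i \<in> K" "j \<in> K" by auto
    then have "h i = h j \<longleftrightarrow> i = j" using h by (auto simp: bij_betw_def inj_on_def)
    moreover have "h i \<in> Q" "h j \<in> Q" using hP ij by (auto simp: P_def)
    ultimately show ?thesis
      using right_singular_basis_inner[OF Q, of "h i" "h j"] ij s[OF ij(1)]
      by (auto simp: u_def v_def simp flip: s_def) (simp add: power2_eq_square)
  qed (auto simp: u_def v_def)
  then have "transpose U ** U = transpose V ** V"
    by (simp add: matrix_mult_transpose_dot_column colU colV)
  moreover have "u j \<noteq> 0 \<longleftrightarrow> j \<in> K" "v j \<noteq> 0 \<longleftrightarrow> j \<in> K" for j
    using s[of j] by (auto simp: u_def v_def s_def)
  then have "{j. column j U \<noteq> 0} = K" "{j. column j V \<noteq> 0} = K" by (simp_all add: colU colV)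
  ultimately show ?thesis using that K cP by (simp add: norm20_def)
qed

section \<open>The lower bound for the truncated penalty\<close>

lemma rank_le_balanced_loss_plus_penalty:
  fixes A :: "real^'n^'m \<Rightarrow> real^'p" and U :: "real^'k^'m" and V :: "real^'k^'n"
  assumes A: "linear A" and rM: "rank M \<ge> 1" and \<nu>: "\<nu> > 0" and \<mu>: "\<mu> > 0"
    and \<alpha>: "\<alpha> = restricted_smallest_eigenvalue (2 * rank M) A"
      "\<alpha> > 2 / (\<nu> * (singular_value (rank M) M)\<^sup>2)"
    and card: "rank M \<le> CARD('k)"
    and \<tau>: "1 < \<tau>" "sqrt \<nu> * onorm A * sqrt (real CARD('k))
                      / (sqrt (\<nu> * \<alpha>) * singular_value (rank M) M - sqrt 2)
                    * sqrt (1 + 2 * sqrt (real (rank M)) / sqrt \<mu>) < \<tau>"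
  shows "real (rank M) \<le> balanced_loss A M \<nu> \<mu> U V
           + 1/2 * (\<Sum>j\<in>UNIV. min 1 (\<tau> * norm (column j U)) + min 1 (\<tau> * norm (column j V)))"
proof (rule ccontr)
  define r where "r = rank M"
  define \<sigma> where "\<sigma> = singular_value (rank M) M"
  define \<delta> where "\<delta> = 2 * sqrt (real r) / sqrt \<mu>"
  define B where "B = balanced_loss A M \<nu> \<mu> U V"
  define E where "E = sqrt (\<nu> * \<alpha>) * \<sigma> - sqrt 2"
  define a where "a j = norm (column j U)" for j
  define b where "b j = norm (column j V)" for j
  define m where "m j = min (a j) (b j)" for j
  \<comment> \<open>Dropping the column pairs outside \<open>J\<close> turns \<open>U V\<^sup>T\<close> into \<open>Y\<close> of rank at most \<open>r - k\<close>. The loss at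
    \<open>Y\<close> exceeds \<open>k\<close> by a margin that the dropped pairs, whose total penalty \<open>T\<close> is less
    than \<open>k\<close>, are too small to make up for.\<close>
  define J where "J = {j. 1 \<le> \<tau> * m j}"
  define T where "T = (\<Sum>j\<in>-J. \<tau> * m j)"
  assume "\<not> real (rank M) \<le> balanced_loss A M \<nu> \<mu> U V
           + 1/2 * (\<Sum>j\<in>UNIV. min 1 (\<tau> * norm (column j U)) + min 1 (\<tau> * norm (column j V)))"
  then have less: "B + 1/2 * (\<Sum>j\<in>UNIV. min 1 (\<tau> * a j) + min 1 (\<tau> * b j)) < real r"
    by (simp add: B_def a_def b_def r_def)
  note th = restricted_eigenvalue_threshold[OF rM \<nu> \<alpha>(2), folded \<sigma>_def]
  have "sqrt 2 < sqrt (\<nu> * \<alpha> * \<sigma>\<^sup>2)" using th(3) by simp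
  then have E: "E > 0" using th(1) by (simp add: E_def real_sqrt_mult)
  have a0: "0 \<le> a j" and b0: "0 \<le> b j" and m0: "0 \<le> m j" for j
    by (auto simp: a_def b_def m_def)
  have T0: "0 \<le> T" unfolding T_def using m0 \<tau>(1) by (intro sum_nonneg) auto
  \<comment> \<open>The smaller norm of a pair bounds both truncated penalties from below, so a pair
    in \<open>J\<close> costs at least 1 and any other at least \<open>\<tau> * m j\<close>.\<close>
  have "real (card J) + T = (\<Sum>j\<in>UNIV. if j \<in> J then 1 else \<tau> * m j)"
    by (simp add: T_def sum.If_cases Compl_eq)
  also have "\<dots> \<le> (\<Sum>j\<in>UNIV. 1/2 * (min 1 (\<tau> * a j) + min 1 (\<tau> * b j)))"
  proof (rule sum_mono)
    fix j
    have "\<tau> * m j \<le> \<tau> * a j" "\<tau> * m j \<le> \<tau> * b j"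
      using \<tau>(1) by (auto simp: m_def)
    then show "(if j \<in> J then 1 else \<tau> * m j) \<le> 1/2 * (min 1 (\<tau> * a j) + min 1 (\<tau> * b j))"
      by (auto simp: J_def min_def)
  qed
  finally have sum: "B + real (card J) + T < real r" using less by (simp add: sum_distrib_left)
  have B: "\<nu> / 2 * (norm (A (U ** transpose V) - A M))\<^sup>2 \<le> B"
      "\<mu> / 4 * (norm (transpose U ** U - transpose V ** V))\<^sup>2 \<le> B"
    using \<nu> \<mu> by (auto simp: B_def balanced_loss_def sq_loss_def)
  have B0: "0 \<le> B" using B(1) \<nu> by (smt (verit) divide_nonneg_nonneg mult_nonneg_nonneg zero_le_power2)
  \<comment> \<open>No truncation occurs in the subtraction, since \<open>sum\<close> gives
    \<open>card J < r\<close>.\<close>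
  define k where "k = r - card J"
  have k: "real k = real r - real (card J)" "k \<le> r" using sum T0 B0 by (auto simp: k_def)
  have Tk: "T < real k" "B < real k" using sum T0 B0 k by auto
  then have k0: "0 < real k" using T0 by linarith
  define X where "X = U ** transpose V"
  define Y where "Y = (\<Sum>j\<in>J. outer_prod (column j U) (column j V))"
  have "norm (transpose U ** U - transpose V ** V) \<le> \<delta>"
  proof (rule power2_le_imp_le)
    have "\<mu> * (norm (transpose U ** U - transpose V ** V))\<^sup>2 \<le> 4 * real r"
      using B(2) sum T0 by (simp add: field_simps)
    then show "(norm (transpose U ** U - transpose V ** V))\<^sup>2 \<le> \<delta>\<^sup>2"
      using \<mu> by (simp add: \<delta>_def power_divide power_mult_distrib field_simps)
    show "0 \<le> \<delta>" using \<mu> by (simp add: \<delta>_def)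
  qed
  then have gap: "\<bar>(a j)\<^sup>2 - (b j)\<^sup>2\<bar> \<le> \<delta>" for j
    using column_norm_gap_le[of j U V] by (simp add: a_def b_def)
  \<comment> \<open>Outside \<open>J\<close> the smaller norm is below 1, and the balancing term
    then bounds the square of the larger one by \<open>1 + \<delta>\<close>. This is the source of
    the last square root in the threshold.\<close>
  have ab: "a j * b j \<le> m j * sqrt (1 + \<delta>)" if "j \<notin> J" for j
  proof -
    have "m j \<le> \<tau> * m j" using mult_right_mono[of 1 \<tau> "m j"] m0 \<tau>(1) by simp
    then have "m j < 1" using that by (auto simp: J_def)
    then have "(m j)\<^sup>2 \<le> 1" using m0[of j] by (simp add: power_le_one)
    then have "(max (a j) (b j))\<^sup>2 \<le> 1 + \<delta>"
      using gap[of j] by (auto simp: m_def max_def min_def split: if_splits)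
    then have "max (a j) (b j) \<le> sqrt (1 + \<delta>)" by (rule real_le_rsqrt)
    moreover have "a j * b j = m j * max (a j) (b j)" by (simp add: m_def min_def max_def)
    ultimately show ?thesis using m0 by (simp add: mult_left_mono)
  qed
  have "X - Y = (\<Sum>j\<in>-J. outer_prod (column j U) (column j V))"
    unfolding X_def Y_def mult_transpose_eq_sum_outer_prod
    by (simp add: Compl_eq_Diff_UNIV sum_diff)
  then have "norm (X - Y) \<le> (\<Sum>j\<in>-J. a j * b j)"
    by (auto simp: a_def b_def norm_outer_prod[symmetric] intro: norm_sum)
  also have "\<dots> \<le> (\<Sum>j\<in>-J. m j * sqrt (1 + \<delta>))" by (intro sum_mono ab) auto
  also have "\<dots> = T / \<tau> * sqrt (1 + \<delta>)"
    using \<tau>(1) by (simp add: T_def sum_distrib_left[symmetric] sum_distrib_right[symmetric])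
  finally have XY: "norm (X - Y) \<le> T / \<tau> * sqrt (1 + \<delta>)" .
  have "rank Y + k \<le> rank M"
    using rank_sum_outer_prod_le[of J "\<lambda>j. column j U" "\<lambda>j. column j V"] k sum T0 B0
    by (simp add: Y_def r_def k_def)
  from linear_image_diff_low_rank_ge[OF A rM this \<alpha>(1)] th(2)
  have "\<nu> * (\<alpha> * (real k * \<sigma>\<^sup>2)) \<le> \<nu> * (norm (A Y - A M))\<^sup>2"
    using \<nu> by (simp add: \<sigma>_def)
  then have "sqrt (\<nu> * (\<alpha> * (real k * \<sigma>\<^sup>2))) \<le> sqrt (\<nu> * (norm (A Y - A M))\<^sup>2)" by simp
  then have lo: "sqrt (real k) * (sqrt (\<nu> * \<alpha>) * \<sigma>) \<le> sqrt \<nu> * norm (A Y - A M)"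
    using th(1) by (simp add: real_sqrt_mult mult_ac)
  have "\<nu> * (norm (A X - A M))\<^sup>2 \<le> 2 * real k" using B(1) Tk by (simp add: X_def)
  then have "sqrt (\<nu> * (norm (A X - A M))\<^sup>2) \<le> sqrt (2 * real k)" by simp
  then have hi: "sqrt \<nu> * norm (A X - A M) \<le> sqrt (real k) * sqrt 2"
    by (simp add: real_sqrt_mult mult_ac)
  have on: "norm (A X - A Y) \<le> onorm A * norm (X - Y)"
    using onorm[of A "X - Y"] A by (simp add: linear_conv_bounded_linear linear_diff)
  have on0: "0 \<le> onorm A" using A by (simp add: linear_conv_bounded_linear onorm_pos_le)
  \<comment> \<open>The residual at \<open>Y\<close> is large by Eckart-Young, the one at
    \<open>X\<close> small because \<open>B < real k\<close>. The gap
    \<open>sqrt (real k) * E\<close> must be bridged by \<open>X - Y\<close>.\<close>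
  have "norm (A Y - A M) \<le> norm (A X - A M) + norm (A X - A Y)"
    using norm_triangle_ineq4[of "A X - A M" "A X - A Y"] by simp
  then have "sqrt \<nu> * norm (A Y - A M) \<le> sqrt \<nu> * norm (A X - A M) + sqrt \<nu> * norm (A X - A Y)"
    using \<nu> by (simp flip: distrib_left)
  then have "sqrt (real k) * E \<le> sqrt \<nu> * norm (A X - A Y)"
    using lo hi by (simp add: E_def algebra_simps)
  also have "\<dots> \<le> sqrt \<nu> * (onorm A * (T / \<tau> * sqrt (1 + \<delta>)))"
    using on XY on0 \<nu> by (intro mult_left_mono order_trans[OF on] XY) auto
  also have "\<dots> \<le> sqrt \<nu> * (onorm A * (sqrt (real k) * sqrt (real CARD('k)) / \<tau> * sqrt (1 + \<delta>)))"
  proof -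
    \<comment> \<open>Only one factor \<open>sqrt (real k)\<close> is enlarged, to the square root
      of \<kappa>; the other cancels against the left-hand side.\<close>
    have "T \<le> sqrt (real k) * sqrt (real k)" using Tk by simp
    also have "\<dots> \<le> sqrt (real k) * sqrt (real CARD('k))"
      using k(2) card by (intro mult_left_mono) (auto simp: r_def)
    finally show ?thesis
      using on0 \<nu> \<tau>(1) \<mu> by (intro mult_left_mono mult_right_mono divide_right_mono) (auto simp: \<delta>_def)
  qed
  also have "\<dots> = sqrt (real k) * (sqrt \<nu> * onorm A * sqrt (real CARD('k)) * sqrt (1 + \<delta>) / \<tau>)"
    by (simp add: mult_ac)
  finally have "E \<le> sqrt \<nu> * onorm A * sqrt (real CARD('k)) * sqrt (1 + \<delta>) / \<tau>"
    by (rule mult_left_le_imp_le) (use k0 in simp)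
  then have "\<tau> \<le> sqrt \<nu> * onorm A * sqrt (real CARD('k)) / E * sqrt (1 + \<delta>)"
    using E \<tau>(1) by (simp add: field_simps)
  then show False using \<tau>(2) by (simp add: E_def \<sigma>_def \<delta>_def r_def)
qed

subsection \<open>Exactness of the penalty\<close>

text \<open>An attained lower bound turns each solution set into a level set, so that solution sets
  of different objectives can be compared pointwise at the common value \<open>r\<close>.\<close>

lemma global_solutions_eq_level_set:
  fixes f :: "'a \<Rightarrow> 'b::linorder"
  assumes "\<And>x. x \<in> S \<Longrightarrow> c \<le> f x" "y \<in> S" "f y = c"
  shows "global_solutions f S = {x \<in> S. f x = c}"
proof -
  have "x \<in> S \<Longrightarrow> (\<forall>z. z \<in> S \<longrightarrow> f x \<le> f z) \<longleftrightarrow> f x = c" for x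
    using assms by (metis antisym)
  then show ?thesis by (auto simp: global_solutions_def is_arg_min_def not_less)
qed

lemma norm20_eq_sum: "real (norm20 U) = (\<Sum>j\<in>UNIV. if column j U = 0 then 0 else 1)"
  by (simp add: norm20_def sum.If_cases Compl_eq card_eq_sum[symmetric])

theorem proposition3p3:
  fixes A :: "real^'n^'m \<Rightarrow> real^'p"
    and M :: "real^'n^'m"
    and \<nu> \<mu> \<alpha> \<rho>bar :: real
    and r :: nat
    and \<phi> :: "real \<Rightarrow> ereal"
  assumes "CARD('m) \<le> CARD('n)"
    and "linear A"
    and "rank M = r" and "r \<ge> 1"
    and "\<nu> > 0" and "\<mu> > 0"
    and "rank_min_solutions A M \<nu> \<inter> low_rank CARD('k::finite) \<noteq> {}"
    and "\<alpha> = restricted_smallest_eigenvalue (2 * r) A"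
    and "\<alpha> > 2 / (\<nu> * (singular_value r M)\<^sup>2)"
    and "\<phi> \<in> surrogate_family"
    and "\<rho>bar = max 1 (sqrt \<nu> * onorm A * sqrt (real CARD('k))
                        / (sqrt (\<nu> * \<alpha>) * singular_value r M - sqrt 2)
                      * sqrt (1 + 2 * sqrt (real r) / sqrt \<mu>))
               * left_deriv \<phi> 1"
  shows "(\<forall>\<rho>>\<rho>bar.
            global_solutions (penalty_objective A M \<nu> \<mu> \<phi> \<rho>)
              (box_set :: ((real^'k^'m) \<times> (real^'k) \<times> (real^'k^'n) \<times> (real^'k)) set)
            = global_solutions (mpec_objective A M \<nu> \<mu> \<phi>) complementarity_set)
       \<and> (\<forall>\<rho>>\<rho>bar.
            global_solutions (surrogate_objective A M \<nu> \<mu> \<phi> \<rho>)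
              (UNIV :: ((real^'k^'m) \<times> (real^'k^'n)) set)
            = global_solutions (column_sparse_objective A M \<nu> \<mu>) UNIV)"
proof -
  define D where "D = left_deriv \<phi> 1"
  obtain g t0 where \<phi>: "\<And>t. t \<in> {0..1} \<Longrightarrow> \<phi> t = ereal (g t)" "\<And>t. t \<in> {0..1} \<Longrightarrow> 0 \<le> g t"
    "g 1 = 1" "t0 \<in> {0..1}" "g t0 = 0" "D \<ge> 1"
    "\<And>t. t \<in> {0..1} \<Longrightarrow> 1 - D * (1 - t) \<le> g t"
    by (rule surrogate_family_properties[OF assms(10), folded D_def]) (rule that; assumption)
  \<comment> \<open>The threshold on the scale of \<open>\<rho> / D\<close>, that is,
    \<open>\<rho>bar = \<tau>0 * D\<close>.\<close>
  define \<tau>0 where "\<tau>0 = max 1 (sqrt \<nu> * onorm A * sqrt (real CARD('k))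
                        / (sqrt (\<nu> * \<alpha>) * singular_value r M - sqrt 2)
                      * sqrt (1 + 2 * sqrt (real r) / sqrt \<mu>))"
  have \<tau>0: "1 \<le> \<tau>0" by (simp add: \<tau>0_def)
  define F :: "real^'k^'m \<Rightarrow> real^'k^'n \<Rightarrow> real" where "F = balanced_loss A M \<nu> \<mu>"
  define a :: "real^'k^'m \<Rightarrow> 'k \<Rightarrow> real" where "a U j = norm (column j U)" for U j
  define b :: "real^'k^'n \<Rightarrow> 'k \<Rightarrow> real" where "b V j = norm (column j V)" for V j
  \<comment> \<open>With \<open>\<tau> = \<rho> / D\<close> this is a common minorant of the lifted
    penalty objective on the box and of the surrogate objective.\<close>
  define W where "W \<tau> U V = F U V + 1/2 * (\<Sum>j\<in>UNIV. min 1 (\<tau> * a U j) + min 1 (\<tau> * b V j))" for \<tau> U V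
  have ab0: "0 \<le> a U j" "0 \<le> b V j" for U V j by (auto simp: a_def b_def)

  have rank_k: "rank M \<le> CARD('k)"
    using rank_le_of_rank_min_solution[of A M \<nu> \<alpha>] assms by (fastforce simp: low_rank_def)
  have W_ge: "real r \<le> W \<tau> U V" if "\<tau>0 < \<tau>" for \<tau> U V
    using rank_le_balanced_loss_plus_penalty[of A M \<nu> \<mu> \<alpha> \<tau> U V] that assms rank_k
    by (simp add: W_def F_def a_def b_def \<tau>0_def)
  obtain U0 :: "real^'k^'m" and V0 :: "real^'k^'n"
    where UV0: "U0 ** transpose V0 = M" "transpose U0 ** U0 = transpose V0 ** V0"
      "norm20 U0 = r" "norm20 V0 = r"
    using ex_balanced_factorization[OF rank_k] assms(3) by metis
  have F0: "F U0 V0 = 0" by (simp add: F_def balanced_loss_def sq_loss_def UV0)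

  have large: "(a U j = 0 \<or> 1 \<le> \<tau> * a U j) \<and> (b V j = 0 \<or> 1 \<le> \<tau> * b V j)"
    if \<tau>: "\<tau>0 < \<tau>" and W: "W \<tau> U V \<le> real r" for \<tau> U V j
  proof -
    \<comment> \<open>The bound \<open>W_ge\<close> also holds for a slightly smaller parameter, so at the minimal value
      decreasing the parameter cannot change the penalty.\<close>
    obtain \<tau>' where \<tau>': "\<tau>0 < \<tau>'" "\<tau>' < \<tau>" using dense[OF \<tau>] by blast
    let ?d = "\<lambda>x. min 1 (\<tau> * x) - min 1 (\<tau>' * x)"
    have d: "0 \<le> ?d x" "?d x \<le> 0 \<Longrightarrow> x = 0 \<or> 1 \<le> \<tau> * x" if "0 \<le> x" for x
    proof -
      have "\<tau>' * x \<le> \<tau> * x" "x \<noteq> 0 \<Longrightarrow> \<tau>' * x < \<tau> * x"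
        using \<tau>' that by (auto intro: mult_right_mono)
      then show "0 \<le> ?d x" "?d x \<le> 0 \<Longrightarrow> x = 0 \<or> 1 \<le> \<tau> * x" by (auto simp: min_def split: if_splits)
    qed
    have "W \<tau> U V - W \<tau>' U V = 1/2 * (\<Sum>j\<in>UNIV. ?d (a U j) + ?d (b V j))"
      by (simp add: W_def sum.distrib sum_subtractf algebra_simps)
    then have "(\<Sum>j\<in>UNIV. ?d (a U j) + ?d (b V j)) \<le> 0"
      using W W_ge[OF \<tau>'(1), of U V] by simp
    moreover have "?d (a U j) + ?d (b V j) \<le> (\<Sum>j\<in>UNIV. ?d (a U j) + ?d (b V j))"
      by (rule member_le_sum) (use d(1) ab0 in \<open>auto intro!: add_nonneg_nonneg\<close>)
    ultimately have "?d (a U j) + ?d (b V j) \<le> 0" by linarith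
    then show ?thesis
      using d(1)[OF ab0(1), of U j] d(1)[OF ab0(2), of V j] d(2)[OF ab0(1), of U j] d(2)[OF ab0(2), of V j]
      by linarith
  qed

  \<comment> \<open>The two equivalences for a fixed \<open>\<rho>\<close> above the
    threshold\<close>
  {
    fix \<rho> assume \<rho>: "\<rho>bar < \<rho>"
    moreover have "\<rho>bar = \<tau>0 * D" unfolding assms(11) \<tau>0_def D_def ..
    ultimately have \<tau>: "\<tau>0 < \<rho> / D" using \<phi>(6) by (simp add: pos_less_divide_eq)
    have pos: "0 < \<rho>'" if "\<tau>0 < \<rho>' / D" for \<rho>'
    proof -
      have "0 < \<rho>' / D" using that \<tau>0 by linarith
      then show ?thesis using \<phi>(6) by (simp add: zero_less_divide_iff)
    qed
    note \<rho>0 = pos[OF \<tau>]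
    \<comment> \<open>Real-valued forms of the lifted objectives on the box, where
      \<open>\<phi>\<close> is finite. The penalty parameter stays an argument of \<open>G\<close>,
      as exactness compares two of its values.\<close>
    define G where "G \<rho> = (\<lambda>(U, u :: real^'k, V, v :: real^'k). F U V + 1/2 * (\<Sum>j\<in>UNIV. g (u $ j) + g (v $ j)
        + \<rho> * (1 - u $ j) * a U j + \<rho> * (1 - v $ j) * b V j))" for \<rho>
    define H where "H = (\<lambda>(U, u :: real^'k, V, v :: real^'k). F U V + 1/2 * (\<Sum>j\<in>UNIV. g (u $ j) + g (v $ j)))"
    have box: "u $ j \<in> {0..1} \<and> v $ j \<in> {0..1}" if "(U, u, V, v) \<in> box_set"
      for U :: "real^'k^'m" and V :: "real^'k^'n" and u v j
      using that by (auto simp: box_set_def less_eq_vec_def)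
    \<comment> \<open>A sum of nonnegative terms vanishes only termwise, so complementarity is a
      condition on each column.\<close>
    have compl: "(U, u, V, v) \<in> complementarity_set \<longleftrightarrow> (U, u, V, v) \<in> box_set \<and>
        (\<forall>j. (1 - u $ j) * a U j = 0 \<and> (1 - v $ j) * b V j = 0)"
      for U :: "real^'k^'m" and V :: "real^'k^'n" and u v
    proof -
      have "(1 - u) \<bullet> column_norms U = (\<Sum>j\<in>UNIV. (1 - u $ j) * a U j)"
           "(1 - v) \<bullet> column_norms V = (\<Sum>j\<in>UNIV. (1 - v $ j) * b V j)"
        by (simp_all add: inner_vec_def column_norms_def a_def b_def)
      moreover have "(\<Sum>j\<in>UNIV. (1 - u $ j) * a U j) = 0 \<longleftrightarrow> (\<forall>j. (1 - u $ j) * a U j = 0)"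
          "(\<Sum>j\<in>UNIV. (1 - v $ j) * b V j) = 0 \<longleftrightarrow> (\<forall>j. (1 - v $ j) * b V j = 0)"
        if "(U, u, V, v) \<in> box_set"
        using box[OF that] ab0 by (subst sum_nonneg_eq_0_iff; force intro: mult_nonneg_nonneg)+
      ultimately show ?thesis
        by (auto simp: complementarity_set_def box_set_def)
    qed
    have pen: "penalty_objective A M \<nu> \<mu> \<phi> \<rho> x = ereal (G \<rho> x)"
      and mpec: "mpec_objective A M \<nu> \<mu> \<phi> x = ereal (H x)" if "x \<in> box_set" for x
    proof -
      obtain U u V v where x: "x = (U, u, V, v)" by (cases x) auto
      have "\<phi> (u $ j) = ereal (g (u $ j))" "\<phi> (v $ j) = ereal (g (v $ j))" for j
        using \<phi>(1) box that x by auto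
      then show "penalty_objective A M \<nu> \<mu> \<phi> \<rho> x = ereal (G \<rho> x)"
        "mpec_objective A M \<nu> \<mu> \<phi> x = ereal (H x)"
        by (simp_all add: x penalty_objective_def mpec_objective_def G_def H_def F_def a_def b_def)
    qed
    have G_ge: "real r \<le> G \<rho>' x" if \<tau>': "\<tau>0 < \<rho>' / D" and x: "x \<in> box_set" for \<rho>' x
    proof -
      obtain U u V v where xe: "x = (U, u, V, v)" by (cases x) auto
      have \<rho>'0: "0 \<le> \<rho>'" using pos[OF \<tau>'] by simp
      have *: "min 1 (\<rho>' / D * y) \<le> g t + \<rho>' * (1 - t) * y" if "t \<in> {0..1}" "0 \<le> y" for t y
        using surrogate_lower_bound[of D "\<rho>' * y" t "g t"] \<phi>(2)[of t] \<phi>(6) \<phi>(7)[of t] that \<rho>'0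
        by (simp add: mult_ac)
      have "W (\<rho>' / D) U V \<le> G \<rho>' x"
        unfolding W_def G_def xe prod.case
      proof (intro add_left_mono mult_left_mono sum_mono)
        fix j
        show "min 1 (\<rho>' / D * a U j) + min 1 (\<rho>' / D * b V j)
          \<le> g (u $ j) + g (v $ j) + \<rho>' * (1 - u $ j) * a U j + \<rho>' * (1 - v $ j) * b V j"
          using *[of "u $ j" "a U j"] *[of "v $ j" "b V j"] box[of U u V v j] x xe ab0 by fastforce
      qed simp
      then show ?thesis using W_ge[OF \<tau>', of U V] by linarith
    qed
    \<comment> \<open>\<open>G\<close> is affine in the penalty parameter, with slope half the total
      complementarity violation at \<open>x\<close>. Were it positive, a smaller parameter still
      above the threshold would push \<open>G\<close> below \<open>r\<close>, against
      \<open>G_ge\<close>.\<close>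
    have in_compl: "x \<in> complementarity_set" if x: "x \<in> box_set" and G: "G \<rho> x = real r" for x
    proof -
      obtain U u V v where xe: "x = (U, u, V, v)" by (cases x) auto
      obtain \<tau>' where \<tau>': "\<tau>0 < \<tau>'" "\<tau>' < \<rho> / D" using dense[OF \<tau>] by blast
      define \<rho>' where "\<rho>' = \<tau>' * D"
      have \<rho>': "\<tau>0 < \<rho>' / D" "\<rho>' < \<rho>" using \<tau>' \<phi>(6) by (auto simp: \<rho>'_def pos_less_divide_eq)
      let ?d = "\<lambda>j. (1 - u $ j) * a U j + (1 - v $ j) * b V j"
      have nn: "0 \<le> (1 - u $ j) * a U j" "0 \<le> (1 - v $ j) * b V j" for j
        using box[of U u V v j] x xe ab0 by auto
      have "G \<rho> x - G \<rho>' x = (\<rho> - \<rho>') / 2 * (\<Sum>j\<in>UNIV. ?d j)"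
        by (simp add: xe G_def sum_distrib_left flip: sum_subtractf)
          (intro sum.cong refl, simp add: field_simps)
      then have "(\<rho> - \<rho>') * (\<Sum>j\<in>UNIV. ?d j) \<le> 0" using G G_ge[OF \<rho>'(1) x] by simp
      then have s: "(\<Sum>j\<in>UNIV. ?d j) \<le> 0" using \<rho>'(2) by (simp add: mult_le_0_iff)
      have "?d j \<le> 0" for j
        using member_le_sum[of j UNIV ?d] nn s by (smt (verit) UNIV_I finite)
      then have "(1 - u $ j) * a U j = 0 \<and> (1 - v $ j) * b V j = 0" for j
        using nn[of j] by (smt (verit))
      then show ?thesis using compl x xe by blast
    qed
    have GH: "G \<rho> x = H x" "x \<in> box_set" if "x \<in> complementarity_set" for x
    proof -
      obtain U u V v where xe: "x = (U, u, V, v)" by (cases x) auto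
      show "x \<in> box_set" using that compl xe by blast
      have "(1 - u $ j) * a U j = 0" "(1 - v $ j) * b V j = 0" for j
        using that compl xe by blast+
      then show "G \<rho> x = H x" by (simp only: xe G_def H_def prod.case mult.assoc) simp
    qed
    \<comment> \<open>A zero column leaves its multiplier free, and \<open>t0\<close> makes it cost
      nothing; a nonzero column requires the value 1, which costs 1. The objective thus counts
      nonzero columns.\<close>
    define u0 :: "real^'k" where "u0 = (\<chi> j. if column j U0 = 0 then t0 else 1)"
    define v0 :: "real^'k" where "v0 = (\<chi> j. if column j V0 = 0 then t0 else 1)"
    let ?x0 = "(U0, u0, V0, v0)"
    have x0: "?x0 \<in> complementarity_set"
      using \<phi>(4) unfolding compl by (auto simp: box_set_def less_eq_vec_def u0_def v0_def a_def b_def)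
    have "(\<Sum>j\<in>UNIV. g (u0 $ j)) = real (norm20 U0)" "(\<Sum>j\<in>UNIV. g (v0 $ j)) = real (norm20 V0)"
      unfolding norm20_eq_sum by (auto simp: u0_def v0_def \<phi> intro!: sum.cong)
    then have H0: "H ?x0 = real r" by (simp add: H_def F0 sum.distrib UV0)
    let ?box = "box_set :: ((real^'k^'m) \<times> (real^'k) \<times> (real^'k^'n) \<times> (real^'k)) set"
    let ?compl = "complementarity_set :: ((real^'k^'m) \<times> (real^'k) \<times> (real^'k^'n) \<times> (real^'k)) set"
    have "global_solutions (penalty_objective A M \<nu> \<mu> \<phi> \<rho>) ?box
        = {x \<in> ?box. penalty_objective A M \<nu> \<mu> \<phi> \<rho> x = ereal (real r)}"
      using G_ge[OF \<tau>] pen GH x0 H0 by (intro global_solutions_eq_level_set[of _ _ _ ?x0]) auto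
    moreover have "global_solutions (mpec_objective A M \<nu> \<mu> \<phi>) ?compl
        = {x \<in> ?compl. mpec_objective A M \<nu> \<mu> \<phi> x = ereal (real r)}"
    proof (rule global_solutions_eq_level_set[OF _ x0])
      show "ereal (real r) \<le> mpec_objective A M \<nu> \<mu> \<phi> x" if "x \<in> ?compl" for x
        using mpec[OF GH(2)] G_ge[OF \<tau> GH(2)] GH(1) that by simp
      show "mpec_objective A M \<nu> \<mu> \<phi> ?x0 = ereal (real r)"
        using mpec[OF GH(2)[OF x0]] H0 by simp
    qed
    moreover have "{x \<in> ?box. penalty_objective A M \<nu> \<mu> \<phi> \<rho> x = ereal (real r)}
        = {x \<in> ?compl. mpec_objective A M \<nu> \<mu> \<phi> x = ereal (real r)}"
    proof (rule Collect_cong)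
      fix x
      show "(x \<in> ?box \<and> penalty_objective A M \<nu> \<mu> \<phi> \<rho> x = ereal (real r))
          = (x \<in> ?compl \<and> mpec_objective A M \<nu> \<mu> \<phi> x = ereal (real r))"
        using pen[of x] mpec[of x] GH[of x] in_compl[of x] by fastforce
    qed
    ultimately have part1: "global_solutions (penalty_objective A M \<nu> \<mu> \<phi> \<rho>) ?box
        = global_solutions (mpec_objective A M \<nu> \<mu> \<phi>) ?compl"
      by simp

    \<comment> \<open>The surrogate problem and the column-sparse problem\<close>
    let ?S = "surrogate_objective A M \<nu> \<mu> \<phi> \<rho> :: (real^'k^'m) \<times> (real^'k^'n) \<Rightarrow> ereal"
    let ?N = "column_sparse_objective A M \<nu> \<mu> :: (real^'k^'m) \<times> (real^'k^'n) \<Rightarrow> real"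
    have N: "?N (U, V) = F U V + 1/2 * (\<Sum>j\<in>UNIV. (if a U j = 0 then 0 else 1) + (if b V j = 0 then 0 else 1))" for U V
      by (simp add: column_sparse_objective_def norm20_eq_sum sum.distrib F_def a_def b_def)
    \<comment> \<open>The sandwich \<open>W \<le> ?S \<le> ?N\<close>, columnwise from the two
      bounds on \<open>theta\<close>.\<close>
    have WS: "ereal (W (\<rho> / D) U V) \<le> ?S (U, V)" and SN: "?S (U, V) \<le> ereal (?N (U, V))" for U V
    proof -
      have lo: "ereal (min 1 (\<rho> / D * y)) \<le> theta \<phi> (\<rho> * y)"
        and up: "theta \<phi> (\<rho> * y) \<le> ereal (if y = 0 then 0 else 1)" if "0 \<le> y" for y
        using theta_bounds[OF assms(10), of "\<rho> * y"] that \<rho>0 by (auto simp: D_def)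
      have "ereal (W (\<rho> / D) U V) = ereal (F U V) + ereal (1/2) *
          (\<Sum>j\<in>UNIV. ereal (min 1 (\<rho> / D * a U j)) + ereal (min 1 (\<rho> / D * b V j)))"
        by (simp only: W_def sum_ereal plus_ereal.simps times_ereal.simps)
      also have "\<dots> \<le> ereal (F U V) + ereal (1/2) *
          (\<Sum>j\<in>UNIV. theta \<phi> (\<rho> * a U j) + theta \<phi> (\<rho> * b V j))"
        by (intro add_left_mono ereal_mult_left_mono sum_mono add_mono lo ab0) simp
      finally show "ereal (W (\<rho> / D) U V) \<le> ?S (U, V)"
        by (simp add: surrogate_objective_def F_def a_def b_def)
      have "ereal (F U V) + ereal (1/2) *
          (\<Sum>j\<in>UNIV. theta \<phi> (\<rho> * a U j) + theta \<phi> (\<rho> * b V j))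
        \<le> ereal (F U V) + ereal (1/2) *
          (\<Sum>j\<in>UNIV. ereal (if a U j = 0 then 0 else 1) + ereal (if b V j = 0 then 0 else 1))"
        by (intro add_left_mono ereal_mult_left_mono sum_mono add_mono up ab0) simp
      also have "\<dots> = ereal (?N (U, V))" unfolding N by simp
      finally show "?S (U, V) \<le> ereal (?N (U, V))"
        by (simp add: surrogate_objective_def F_def a_def b_def)
    qed
    \<comment> \<open>At value \<open>r\<close>, \<open>large\<close> makes every nonzero column
      cost exactly 1 in \<open>W\<close>, so \<open>W\<close> coincides there with the count in
      \<open>?N\<close>.\<close>
    have NW: "?N (U, V) \<le> real r" if "?S (U, V) = ereal (real r)" for U V
    proof -
      have Wr: "W (\<rho> / D) U V \<le> real r" using WS[of U V] that by simp
      have "?N (U, V) \<le> W (\<rho> / D) U V"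
        unfolding N W_def
        by (intro add_left_mono mult_left_mono sum_mono add_mono) (use large[OF \<tau> Wr] in auto)
      then show ?thesis using Wr by linarith
    qed
    have S_ge: "ereal (real r) \<le> ?S x" for x
      using order_trans[OF _ WS[of "fst x" "snd x"]] W_ge[OF \<tau>, of "fst x" "snd x"] by simp
    have N_ge: "real r \<le> ?N x" for x
      using order_trans[OF S_ge[of x] SN[of "fst x" "snd x", simplified]] by simp
    have N0: "?N (U0, V0) = real r"
      using F0 by (simp add: column_sparse_objective_def F_def UV0)
    have S0: "?S (U0, V0) = ereal (real r)"
      using SN[of U0 V0] S_ge[of "(U0, V0)"] N0 by (simp add: antisym)
    have "global_solutions ?S UNIV = {x \<in> UNIV. ?S x = ereal (real r)}"
      using S_ge S0 by (intro global_solutions_eq_level_set) auto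
    moreover have "global_solutions ?N UNIV = {x \<in> UNIV. ?N x = real r}"
      using N_ge N0 by (intro global_solutions_eq_level_set) auto
    moreover have "?S x = ereal (real r) \<longleftrightarrow> ?N x = real r" for x
    proof
      show "?N x = real r" if "?S x = ereal (real r)"
        using NW[of "fst x" "snd x"] that N_ge[of x] by simp
      show "?S x = ereal (real r)" if "?N x = real r"
        using SN[of "fst x" "snd x"] S_ge[of x] that by (simp add: antisym)
    qed
    ultimately have part2: "global_solutions ?S UNIV = global_solutions ?N UNIV" by simp
    note part1 part2
  }
  then show ?thesis by blast
qed

end
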